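(* For $n\ge0$ let $p_n=\prod_{m=0}^{n-1}\big(y-c+\tfrac{m(m+1)}2\big)\in\mathcal S$ (product in the cross-product algebra). Then $\{p_n\}_{n\ge0}$ is a basis of the free $\mathbb C[c]$-module $\mathcal S$ and $\langle p_n,p_k\rangle=0$ for all $n\ne k$.
   Context: Let $x_1=\tfrac12\begin{pmatrix}0&1\\1&0\end{pmatrix}$, $x_2=\tfrac12\begin{pmatrix}0&-i\\ i&0\end{pmatrix}$, $x_3=\tfrac12\begin{pmatrix}1&0\\0&-1\end{pmatrix}$, $c=x_1^2+x_2^2+x_3^2$. For a chord diagram $D$ (oriented circle with $2n$ points paired into chords, up to orientation-preserving diffeomorphism), $w_{\mathfrak{sl}_2}(D)=\sum_\varphi x_{\varphi(p_1)}\cdots x_{\varphi(p_{2n})}\in\mathbb C[c]$, $p_i$ the endpoints in order from a cut point and $\varphi$ over maps chords$\to\{1,2,3\}$. A share: two oriented intervals (strand 1, strand 2) with finitely many chords (disjoint pairs of distinct points), up to orientation-preserving diffeomorphisms of each strand; arches have both ends on one strand, bridges one end on each. $A_2$ = $\mathbb C$-span of shares. Join $(I,H)$: chord diagram whose circle reads strand 1 of $I$, strand 1 of $H$, strand 2 of $I$, strand 2 of $H$ (bilinear). $I\sim I'$ iff $w_{\mathfrak{sl}_2}((I,H))=w_{\mathfrak{sl}_2}((I',H))$ for all shares $H$; $\mathcal S=A_2/\!\sim$. Cross product $I\times H$: strand 1 is strand 1 of $I$ followed by strand 1 of $H$, strand 2 is strand 2 of $H$ followed by strand 2 of $I$; it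 makes $\mathcal S$ a commutative $\mathbb C[c]$-algebra isomorphic to $\mathbb C[c][y]$, where $c$ is the class of the share with one arch and $y$ the class of the share with one bridge; $y^m$ is the class of the share with $m$ bridges $b_1,\dots,b_m$ in order $b_1,\dots,b_m$ on strand 1 and $b_m,\dots,b_1$ on strand 2. The $\mathbb C[c]$-bilinear form on $\mathcal S$ is $\langle I,H\rangle=w_{\mathfrak{sl}_2}((I,H))$. *)

theory Defs
  imports Complex_Main "HOL-Library.Poly_Mapping" "HOL-Computational_Algebra.Polynomial"
    "HOL-Library.FuncSet"
begin

text \<open>Matrices are functions nat => nat => complex, meaningful on indices < d.
  In the d-dimensional irreducible representation of sl2 (spin j = (d-1)/2, basis
  index a corresponds to weight m = j - a) we use J_+, J_-, J_z and put
  x1 = (J_+ + J_-)/2, x2 = (J_+ - J_-)/(2i), x3 = J_z. For d = 2 these are exactly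
  the matrices x1, x2, x3 of the paper; the Casimir c = x1^2+x2^2+x3^2 acts by
  j(j+1) = (d^2-1)/4.\<close>

type_synonym cmat = "nat \<Rightarrow> nat \<Rightarrow> complex"

definition jplus :: "nat \<Rightarrow> cmat" where
  "jplus d i k = (if k < d \<and> i + 1 = k then complex_of_real (sqrt (real k * real (d - k))) else 0)"

definition jminus :: "nat \<Rightarrow> cmat" where
  "jminus d i k = jplus d k i"

definition jz :: "nat \<Rightarrow> cmat" where
  "jz d i k = (if i = k \<and> i < d then complex_of_real ((real d - 1) / 2 - real i) else 0)"

definition xgen :: "nat \<Rightarrow> nat \<Rightarrow> cmat" where
  "xgen d a = (if a = 1 then (\<lambda>i k. (jplus d i k + jminus d i k) / 2)
               else if a = 2 then (\<lambda>i k. (jplus d i k - jminus d i k) / (2 * \<i>))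
               else jz d)"

definition mmul :: "nat \<Rightarrow> cmat \<Rightarrow> cmat \<Rightarrow> cmat" where
  "mmul d A B = (\<lambda>i k. \<Sum>j<d. A i j * B j k)"

definition mid :: "nat \<Rightarrow> cmat" where
  "mid d = (\<lambda>i k. if i = k \<and> i < d then 1 else 0)"

text \<open>A chord diagram is given by the word of chord labels read along the circle from a
  cut point (each label occurring exactly twice).\<close>

definition wordmat :: "nat \<Rightarrow> (nat \<Rightarrow> nat) \<Rightarrow> nat list \<Rightarrow> cmat" where
  "wordmat d \<phi> w = foldr (\<lambda>l M. mmul d (xgen d (\<phi> l)) M) w (mid d)"

definition sl2sum :: "nat \<Rightarrow> nat list \<Rightarrow> cmat" where
  "sl2sum d w = (\<lambda>i k. \<Sum>\<phi>\<in>(set w \<rightarrow>\<^sub>E {1,2,3}). wordmat d \<phi> w i k)"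

definition casimir_val :: "nat \<Rightarrow> complex" where
  "casimir_val d = ((of_nat d)^2 - 1) / 4"

text \<open>w_sl2(D) in C[c]: the polynomial P such that the element
  sum_phi x_phi(p1) ... x_phi(p2n) of U(sl2) acts as P(c) in every finite-dimensional
  irreducible representation.\<close>

definition w_sl2 :: "nat list \<Rightarrow> complex poly" where
  "w_sl2 w = (THE P. \<forall>d\<ge>1. \<forall>i<d. \<forall>k<d.
      sl2sum d w i k = (if i = k then poly P (casimir_val d) else 0))"

type_synonym share = "nat list \<times> nat list"

definition wf_share :: "share \<Rightarrow> bool" where
  "wf_share s = (\<forall>l \<in> set (fst s @ snd s). count_list (fst s @ snd s) l = 2)"

definition lab1 :: "nat \<Rightarrow> nat" where "lab1 l = 2 * l"
definition lab2 :: "nat \<Rightarrow> nat" where "lab2 l = 2 * l + 1"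

definition join_share :: "share \<Rightarrow> share \<Rightarrow> nat list" where
  "join_share I H = map lab1 (fst I) @ map lab2 (fst H) @ map lab1 (snd I) @ map lab2 (snd H)"

definition cross_share :: "share \<Rightarrow> share \<Rightarrow> share" where
  "cross_share I H = (map lab1 (fst I) @ map lab2 (fst H), map lab2 (snd H) @ map lab1 (snd I))"

type_synonym a2 = "share \<Rightarrow>\<^sub>0 complex"

definition wf_a2 :: "a2 \<Rightarrow> bool" where
  "wf_a2 I = (\<forall>s\<in>Poly_Mapping.keys I. wf_share s)"

definition a2_cross :: "a2 \<Rightarrow> a2 \<Rightarrow> a2" where
  "a2_cross I H = (\<Sum>s\<in>Poly_Mapping.keys I. \<Sum>t\<in>Poly_Mapping.keys H.
      Poly_Mapping.single (cross_share s t) (Poly_Mapping.lookup I s * Poly_Mapping.lookup H t))"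

definition a2_form :: "a2 \<Rightarrow> a2 \<Rightarrow> complex poly" where
  "a2_form I H = (\<Sum>s\<in>Poly_Mapping.keys I. \<Sum>t\<in>Poly_Mapping.keys H.
      smult (Poly_Mapping.lookup I s * Poly_Mapping.lookup H t) (w_sl2 (join_share s t)))"

definition a2_sim :: "a2 \<Rightarrow> a2 \<Rightarrow> bool" where
  "a2_sim I I' = (\<forall>H. wf_share H \<longrightarrow>
      a2_form I (Poly_Mapping.single H 1) = a2_form I' (Poly_Mapping.single H 1))"

definition a2_scale :: "complex \<Rightarrow> a2 \<Rightarrow> a2" where
  "a2_scale a x = (\<Sum>s\<in>Poly_Mapping.keys x. Poly_Mapping.single s (a * Poly_Mapping.lookup x s))"

definition a2_one :: a2 where "a2_one = Poly_Mapping.single ([], []) 1"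
definition arch :: a2 where "arch = Poly_Mapping.single ([0, 0], []) 1"
definition bridge :: a2 where "bridge = Poly_Mapping.single ([0], [0]) 1"

definition a2_pow :: "a2 \<Rightarrow> nat \<Rightarrow> a2" where
  "a2_pow x n = (a2_cross x ^^ n) a2_one"

definition cpoly :: "complex poly \<Rightarrow> a2" where
  "cpoly q = (\<Sum>i\<le>degree q. a2_scale (coeff q i) (a2_pow arch i))"

definition pfac :: "nat \<Rightarrow> a2" where
  "pfac m = bridge - arch + a2_scale (of_nat (m * (m + 1)) / 2) a2_one"

definition pp :: "nat \<Rightarrow> a2" where
  "pp n = foldr (\<lambda>m acc. a2_cross (pfac m) acc) [0..<n] a2_one"

end

theory Submission
  imports Defs
begin

text \<open>
  A share acts on square matrices by inserting a matrix X between its two strands: X is sent to the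
  sum over all colourings of (word of strand 1) X (word of strand 2). The cross product becomes
  composition, an arch acts by c and the bridge by Y X = x1 X x1 + x2 X x2 + x3 X x3. The tensor of
  a chord is invariant, so these operators commute with the adjoint action of sl2. By Schur's lemma
  they act on the matrices of spin l by a scalar; for Y it is c - l(l+1)/2, hence p_n kills exactly
  the spins l < n.

  By Kostant's separation of variables every word of length n in the generators is a combination of
  the harmonic elements (ad f)^j e^l with l \<le> n, with coefficients in C[c]. So the scalars of a
  share are polynomials in c (the case l = 0 is the weight system itself), and p_n kills all words
  of length less than n. Since the trace of a product is cyclic, the latter makes p_n orthogonal to all
  shares whose second strand has fewer than n endpoints, in particular to p_k for k < n.

  Up to a nonzero factor, the pairing of p_n with itself is the sum of the squared norms of p_n
  applied to the words of length n. It is not zero because p_n does not kill e^n.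

  Newton interpolation of the scalars of I at the spins 0, 1, 2, ... gives polynomials q_n with
  (I, p_n) = q_n (p_n, p_n). By orthogonality they vanish for large n, so that I is equivalent to
  the finite sum of the q_n p_n.
\<close>

section \<open>Linear algebra and finite sums\<close>

lemma (in module) sum_eigenvectors_eq_0:
  assumes "module_hom scale scale T" "finite B" "x = sum v B" "T x = l *s x"
    and "\<And>b. b \<in> B \<Longrightarrow> T (v b) = m b *s v b" "\<And>b. b \<in> B \<Longrightarrow> l - m b dvd 1"
  shows "x = 0"
  using assms(2-)
proof (induction B arbitrary: v)
  case (insert b B)
  interpret T: module_hom scale scale T by (fact assms(1))
  obtain u where u: "1 = (l - m b) * u" using insert.prems(4)[of b] by (auto elim: dvdE)
  define w where "w c = (u * (m c - m b)) *s v c" for c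
  have "x = u *s ((l - m b) *s x)"
    using u by (simp add: mult.commute)
  also have "(l - m b) *s x = T x - m b *s x"
    by (simp add: insert.prems(2) scale_left_diff_distrib)
  also have "\<dots> = (\<Sum>c\<in>B. (m c - m b) *s v c)"
    using insert.hyps insert.prems(3)
    by (simp add: insert.prems(1) T.add T.sum scale_right_distrib scale_sum_right
        scale_left_diff_distrib sum_subtractf)
  finally have "x = sum w B"
    by (simp add: w_def scale_sum_right)
  moreover have "T (w c) = m c *s w c" if "c \<in> B" for c
    using that insert.prems(3) by (simp add: w_def T.scale mult_ac)
  ultimately show ?case
    using insert.IH[of w] insert.prems(2,4) by blast
qed simp

fun newton_coeff :: "(nat \<Rightarrow> nat \<Rightarrow> 'a::field) \<Rightarrow> (nat \<Rightarrow> 'a poly) \<Rightarrow> nat \<Rightarrow> 'a poly" where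
  "newton_coeff m z l = smult (inverse (m l l)) (z l - (\<Sum>n<l. smult (m n l) (newton_coeff m z n)))"

declare newton_coeff.simps [simp del]

lemma sum_newton_coeff:
  assumes "m l l \<noteq> 0"
  shows "(\<Sum>n\<le>l. smult (m n l) (newton_coeff m z n)) = z l"
proof -
  have "smult (m l l) (newton_coeff m z l) = z l - (\<Sum>n<l. smult (m n l) (newton_coeff m z n))"
    using assms by (subst newton_coeff.simps) simp
  then show ?thesis by (simp add: lessThan_Suc_atMost[symmetric])
qed

lemma sum_PiE_insert:
  assumes "x \<notin> S"
  shows "(\<Sum>f\<in>Pi\<^sub>E (insert x S) T. F f) = (\<Sum>f\<in>Pi\<^sub>E S T. \<Sum>y\<in>T x. F (f(x := y)))"
proof -
  have "(\<Sum>f\<in>Pi\<^sub>E (insert x S) T. F f) = (\<Sum>(y, f)\<in>T x \<times> Pi\<^sub>E S T. F (f(x := y)))"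
    unfolding PiE_insert_eq
    by (subst sum.reindex[OF inj_combinator[OF assms]]) (simp add: case_prod_unfold)
  also have "\<dots> = (\<Sum>y\<in>T x. \<Sum>f\<in>Pi\<^sub>E S T. F (f(x := y)))"
    by (simp add: sum.cartesian_product)
  finally show ?thesis by (subst sum.swap)
qed

lemma sum_PiE_disjoint_images:
  fixes f :: "'a \<Rightarrow> 'c" and g :: "'b \<Rightarrow> 'c" and C :: "'d set"
  assumes "inj f" "inj g" "range f \<inter> range g = {}"
  shows "(\<Sum>\<phi>\<in>f ` A \<union> g ` B \<rightarrow>\<^sub>E C. F (\<phi> \<circ> f) (\<phi> \<circ> g)) = (\<Sum>\<alpha>\<in>A \<rightarrow>\<^sub>E C. \<Sum>\<beta>\<in>B \<rightarrow>\<^sub>E C. F \<alpha> \<beta>)"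
proof -
  define glue :: "('a \<Rightarrow> 'd) \<times> ('b \<Rightarrow> 'd) \<Rightarrow> 'c \<Rightarrow> 'd" where
    "glue p l = (if l \<in> range f then fst p (inv f l)
      else if l \<in> range g then snd p (inv g l) else undefined)" for p l
  have disj: "f k \<noteq> g l" for k l using assms(3) by blast
  then have [simp]: "g l \<notin> range f" "f k \<notin> g ` B" "g l \<notin> f ` A" for k l by (metis imageE rangeE)+
  have glue: "glue p (f k) = fst p k" "glue p (g l) = snd p l" for p k l
    using assms(1,2) by (simp_all add: glue_def)
  have "(\<Sum>\<phi>\<in>f ` A \<union> g ` B \<rightarrow>\<^sub>E C. F (\<phi> \<circ> f) (\<phi> \<circ> g)) = (\<Sum>p\<in>(A \<rightarrow>\<^sub>E C) \<times> (B \<rightarrow>\<^sub>E C). F (fst p) (snd p))"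
  proof (rule sum.reindex_bij_witness[of _ glue "\<lambda>\<phi>. (\<phi> \<circ> f, \<phi> \<circ> g)"])
    fix \<phi> assume \<phi>: "\<phi> \<in> f ` A \<union> g ` B \<rightarrow>\<^sub>E C"
    then have outside: "\<phi> l = undefined" if "l \<notin> f ` A \<union> g ` B" for l
      using that by (rule PiE_arb)
    show "glue (\<phi> \<circ> f, \<phi> \<circ> g) = \<phi>"
    proof
      fix l show "glue (\<phi> \<circ> f, \<phi> \<circ> g) l = \<phi> l"
        by (cases "l \<in> range f \<union> range g")
          (auto simp: glue, auto simp: glue_def intro!: outside[symmetric])
    qed
    show "(\<phi> \<circ> f, \<phi> \<circ> g) \<in> (A \<rightarrow>\<^sub>E C) \<times> (B \<rightarrow>\<^sub>E C)"
      using \<phi> assms(1,2) by (auto simp: disj disj[symmetric] dest: injD intro!: outside)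
  next
    fix p assume p: "p \<in> (A \<rightarrow>\<^sub>E C) \<times> (B \<rightarrow>\<^sub>E C)"
    show "(glue p \<circ> f, glue p \<circ> g) = p"
      by (simp add: prod_eq_iff fun_eq_iff glue)
    show "glue p \<in> f ` A \<union> g ` B \<rightarrow>\<^sub>E C"
    proof (rule PiE_I)
      fix l assume "l \<notin> f ` A \<union> g ` B"
      then show "glue p l = undefined"
        using p by (cases "l \<in> range f \<union> range g") (auto simp: glue, auto simp: glue_def)
    qed (use p in \<open>auto simp: glue\<close>)
  qed (simp_all)
  then show ?thesis by (simp add: sum.cartesian_product case_prod_unfold)
qed

lemma pronic_eq_iff: "m * (m + 1) = n * (n + 1) \<longleftrightarrow> m = n" for m n :: nat
proof -
  have "k * (k + 1) < l * (l + 1)" if "k < l" for k l :: nat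
    using that by (intro mult_strict_mono) auto
  then show ?thesis by (metis less_irrefl nat_neq_iff)
qed

section \<open>Commutators and derivatives of words\<close>

definition ad :: "'a::ring \<Rightarrow> 'a \<Rightarrow> 'a" where
  "ad g X = g * X - X * g"

lemma ad_mult: "ad g (X * Z) = ad g X * Z + X * ad g Z"
  by (simp add: ad_def algebra_simps)

lemma ad_self [simp]: "ad g g = 0"
  by (simp add: ad_def)

lemma ad_swap: "ad x y = - ad y x"
  by (simp add: ad_def)

primrec word_deriv :: "('l \<Rightarrow> 'a::ring_1) \<Rightarrow> 'l \<Rightarrow> 'a \<Rightarrow> 'l list \<Rightarrow> 'a" where
  "word_deriv f l D [] = 0"
| "word_deriv f l D (k # w) =
    (if k = l then D * prod_list (map f w) else 0) + f k * word_deriv f l D w"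

lemma ad_prod_list:
  assumes "finite A" "set w \<subseteq> A"
  shows "ad g (prod_list (map f w)) = (\<Sum>l\<in>A. word_deriv f l (ad g (f l)) w)"
  using assms(2)
proof (induction w)
  case Nil
  show ?case by (simp add: ad_def)
next
  case (Cons k w)
  have "(\<Sum>l\<in>A. if k = l then ad g (f l) * prod_list (map f w) else 0) =
      ad g (f k) * prod_list (map f w)"
    using Cons.prems assms(1) by (simp add: sum.delta)
  then show ?case
    using Cons by (simp add: ad_mult sum.distrib sum_distrib_left)
qed

lemma word_deriv_notin: "l \<notin> set w \<Longrightarrow> word_deriv f l D w = 0"
  by (induction w) auto

lemma prod_list_map_fun_upd_notin:
  "l \<notin> set w \<Longrightarrow> prod_list (map (f(l := A)) w) = prod_list (map f w)"
  by (rule arg_cong[of _ _ prod_list]) auto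

lemma word_deriv_once:
  "count_list w l = 1 \<Longrightarrow> word_deriv f l D w = prod_list (map (f(l := D)) w)"
  by (induction w)
    (auto simp: word_deriv_notin count_list_0_iff prod_list_map_fun_upd_notin split: if_splits)

lemma word_deriv_twice_commute:
  "count_list w l = 2 \<Longrightarrow> word_deriv (f(l := A)) l B w = word_deriv (f(l := B)) l A w"
proof (induction w)
  case (Cons k w)
  show ?case
  proof (cases "k = l")
    case True
    then have "count_list w l = 1" using Cons.prems by simp
    then show ?thesis using True
      by (simp add: word_deriv_once add.commute del: fun_upd_apply) (simp add: add.commute)
  qed (use Cons in auto)
qed simp

section \<open>Families of matrices\<close>

lemma mmul_assoc: "mmul d (mmul d A B) C = mmul d A (mmul d B C)"
proof (intro ext)
  fix i k
  have "mmul d (mmul d A B) C i k = (\<Sum>j<d. \<Sum>l<d. A i l * (B l j * C j k))"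
    by (simp add: mmul_def sum_distrib_right mult.assoc)
  also have "\<dots> = (\<Sum>l<d. \<Sum>j<d. A i l * (B l j * C j k))"
    by (rule sum.swap)
  also have "\<dots> = mmul d A (mmul d B C) i k"
    by (simp add: mmul_def sum_distrib_left)
  finally show "mmul d (mmul d A B) C i k = mmul d A (mmul d B C) i k" .
qed

lemma mmul_diag_left:
  assumes "\<And>j. j \<noteq> i \<Longrightarrow> D i j = 0"
  shows "mmul d D A i k = (if i < d then D i i * A i k else 0)"
proof -
  have "mmul d D A i k = (\<Sum>j<d. if j = i then D i i * A i k else 0)"
    unfolding mmul_def by (rule sum.cong) (auto simp: assms)
  then show ?thesis by simp
qed

lemma mmul_diag_right:
  assumes "\<And>j. j \<noteq> k \<Longrightarrow> D j k = 0"
  shows "mmul d A D i k = (if k < d then A i k * D k k else 0)"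
proof -
  have "mmul d A D i k = (\<Sum>j<d. if j = k then A i k * D k k else 0)"
    unfolding mmul_def by (rule sum.cong) (auto simp: assms)
  then show ?thesis by simp
qed

text \<open>One matrix for every dimension: an identity in this ring holds in all irreducible
  representations at once.\<close>

typedef mfam = "{M :: nat \<Rightarrow> cmat. \<forall>d i k. \<not> (i < d \<and> k < d) \<longrightarrow> M d i k = 0}"
  morphisms entry Abs_mfam
  by (rule exI[of _ "\<lambda>_ _ _. 0"]) simp

setup_lifting type_definition_mfam

lemma entry_outside: "\<not> (i < d \<and> k < d) \<Longrightarrow> entry A d i k = 0"
  using entry[of A] by blast

lemma mfam_eqI: "(\<And>d i k. i < d \<Longrightarrow> k < d \<Longrightarrow> entry A d i k = entry B d i k) \<Longrightarrow> A = B"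
  by (metis entry_outside entry_inject ext)

instantiation mfam :: ring_1
begin

lift_definition zero_mfam :: mfam is "\<lambda>_ _ _. 0" by simp
lift_definition one_mfam :: mfam is "\<lambda>d. mid d" by (auto simp: mid_def)
lift_definition plus_mfam :: "mfam \<Rightarrow> mfam \<Rightarrow> mfam" is "\<lambda>A B d i k. A d i k + B d i k" by simp
lift_definition minus_mfam :: "mfam \<Rightarrow> mfam \<Rightarrow> mfam" is "\<lambda>A B d i k. A d i k - B d i k" by simp
lift_definition uminus_mfam :: "mfam \<Rightarrow> mfam" is "\<lambda>A d i k. - A d i k" by simp
lift_definition times_mfam :: "mfam \<Rightarrow> mfam \<Rightarrow> mfam" is "\<lambda>A B d. mmul d (A d) (B d)"
  by (auto simp: mmul_def intro!: sum.neutral)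

instance
proof
  fix a b c :: mfam
  show "a * b * c = a * (b * c)"
    by transfer (simp add: mmul_assoc)
  show "1 * a = a"
    by transfer (auto simp: fun_eq_iff mmul_diag_left mid_def)
  show "a * 1 = a"
    by transfer (auto simp: fun_eq_iff mmul_diag_right mid_def)
  show "(a + b) * c = a * c + b * c" "a * (b + c) = a * b + a * c"
    by (transfer, simp add: mmul_def algebra_simps sum.distrib)+
  have "mid 1 0 0 = 1" by (simp add: mid_def)
  then show "(0 :: mfam) \<noteq> 1"
    by transfer (metis zero_neq_one)
qed (transfer; simp add: fun_eq_iff)+

end

lift_definition smul :: "complex poly \<Rightarrow> mfam \<Rightarrow> mfam" (infixr "\<bullet>" 75)
  is "\<lambda>p A d i k. poly p (casimir_val d) * A d i k" by simp

interpretation mf: module smul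
  by standard (transfer; simp add: algebra_simps fun_eq_iff)+

lemma smul_mult_left [simp]: "(p \<bullet> A) * B = p \<bullet> (A * B)"
  by transfer (simp add: mmul_def sum_distrib_left mult.assoc)

lemma smul_mult_right [simp]: "A * (p \<bullet> B) = p \<bullet> (A * B)"
  by transfer (simp add: mmul_def sum_distrib_left mult.left_commute)

lemma entry_sum: "entry (sum f S) d i k = (\<Sum>s\<in>S. entry (f s) d i k)"
  by (induction S rule: infinite_finite_induct) (simp_all add: zero_mfam.rep_eq plus_mfam.rep_eq)

lemmas entry_simps =
  zero_mfam.rep_eq plus_mfam.rep_eq minus_mfam.rep_eq uminus_mfam.rep_eq smul.rep_eq

abbreviation cst :: "complex \<Rightarrow> complex poly" where "cst z \<equiv> [:z:]"

abbreviation cas :: "complex poly" where "cas \<equiv> [:0, 1:]"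

lemma cst_one_smul [simp]: "cst 1 \<bullet> X = X"
  by (simp flip: one_pCons)

lemma cst_add_smul: "cst (a + b) \<bullet> X = cst a \<bullet> X + cst b \<bullet> X"
  by (simp flip: mf.scale_left_distrib)

lemma is_unit_cst: "z \<noteq> 0 \<Longrightarrow> cst z dvd 1"
  by (simp add: is_unit_pCons_iff)

lemma inj_casimir_val: "inj casimir_val"
proof
  fix d d' assume "casimir_val d = casimir_val d'"
  then have "of_nat (d ^ 2) = (of_nat (d' ^ 2) :: complex)"
    by (simp add: casimir_val_def)
  then show "d = d'" by (simp only: of_nat_eq_iff) simp
qed

lemma poly_eqI_casimir:
  assumes "\<And>d. d > 0 \<Longrightarrow> poly p (casimir_val d) = poly q (casimir_val d)"
  shows "p = q"
proof (rule ccontr)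
  assume "p \<noteq> q"
  then have "finite {x. poly (p - q) x = 0}" by (intro poly_roots_finite) simp
  moreover have "casimir_val ` {0<..} \<subseteq> {x. poly (p - q) x = 0}" using assms by auto
  ultimately have "finite (casimir_val ` {0<..})" by (rule rev_finite_subset)
  then show False
    by (simp add: finite_image_iff inj_on_subset[OF inj_casimir_val] infinite_Ioi)
qed

lemma smul_one_eq_iff: "p \<bullet> 1 = q \<bullet> 1 \<longleftrightarrow> p = q"
proof
  assume eq: "p \<bullet> 1 = q \<bullet> 1"
  show "p = q"
  proof (rule poly_eqI_casimir)
    fix d :: nat assume "d > 0"
    then show "poly p (casimir_val d) = poly q (casimir_val d)"
      using arg_cong[OF eq, of "\<lambda>A. entry A d 0 0"]
      by (simp add: smul.rep_eq one_mfam.rep_eq mid_def)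
  qed
qed simp

section \<open>The generators of sl2\<close>

lift_definition sl2_e :: mfam is jplus by (auto simp: jplus_def)
lift_definition sl2_f :: mfam is jminus by (auto simp: jminus_def jplus_def)
lift_definition sl2_h :: mfam is jz by (auto simp: jz_def)
lift_definition sl2_x :: "nat \<Rightarrow> mfam" is "\<lambda>a d. xgen d a"
  by (auto simp: xgen_def jplus_def jminus_def jz_def)

lemmas generator_entries = sl2_e.rep_eq sl2_f.rep_eq sl2_h.rep_eq sl2_x.rep_eq

lemma jplus_square:
  assumes "Suc i < d"
  shows "jplus d i (Suc i) * jplus d i (Suc i) = of_nat (Suc i) * (of_nat d - of_nat (Suc i))"
proof -
  have "jplus d i (Suc i) * jplus d i (Suc i) = complex_of_real (real (Suc i) * real (d - Suc i))"
    using assms by (simp add: jplus_def del: of_nat_Suc flip: of_real_mult)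
  then show ?thesis using assms by (simp add: of_nat_diff)
qed

lemma mmul_jplus_jminus:
  "mmul d (jplus d) (jminus d) i k =
    (if i = k \<and> Suc i < d then of_nat (Suc i) * (of_nat d - of_nat (Suc i)) else 0)"
proof -
  have "mmul d (jplus d) (jminus d) i k =
      (\<Sum>j<d. if j = Suc i then jplus d i (Suc i) * jplus d k (Suc i) else 0)"
    unfolding mmul_def jminus_def by (rule sum.cong) (auto simp: jplus_def)
  also have "\<dots> = (if Suc i < d then jplus d i (Suc i) * jplus d k (Suc i) else 0)" by simp
  also have "\<dots> = (if i = k \<and> Suc i < d then jplus d i (Suc i) * jplus d i (Suc i) else 0)"
    by (auto simp: jplus_def)
  finally show ?thesis using jplus_square by (simp del: of_nat_Suc)
qed

lemma mmul_jminus_jplus: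
  "mmul d (jminus d) (jplus d) i k =
    (if i = k \<and> i < d then of_nat i * (of_nat d - of_nat i) else 0)"
proof (cases i)
  case 0
  then show ?thesis by (auto simp: mmul_def jminus_def jplus_def intro!: sum.neutral)
next
  case (Suc i')
  have "mmul d (jminus d) (jplus d) i k =
      (\<Sum>j<d. if j = i' then jplus d i' (Suc i') * jplus d i' k else 0)"
    unfolding mmul_def jminus_def by (rule sum.cong) (auto simp: jplus_def Suc)
  also have "\<dots> = (if i' < d then jplus d i' (Suc i') * jplus d i' k else 0)" by simp
  also have "\<dots> = (if i = k \<and> i < d then jplus d i' (Suc i') * jplus d i' (Suc i') else 0)"
    by (auto simp: jplus_def Suc)
  finally show ?thesis using jplus_square[of i' d] Suc by (auto simp del: of_nat_Suc)
qed

lemma mmul_jz_left: "mmul d (jz d) A i k = (if i < d then jz d i i * A i k else 0)"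
  by (rule mmul_diag_left) (simp add: jz_def)

lemma mmul_jz_right: "mmul d A (jz d) i k = (if k < d then A i k * jz d k k else 0)"
  by (rule mmul_diag_right) (simp add: jz_def)

lemma sl2_e_mult_f: "sl2_e * sl2_f = sl2_f * sl2_e + cst 2 \<bullet> sl2_h"
proof (rule mfam_eqI)
  fix d i k :: nat assume "i < d" "k < d"
  then consider "i \<noteq> k" | "i = k" "i + 1 < d" | "i = k" "d = i + 1" by linarith
  then show "entry (sl2_e * sl2_f) d i k = entry (sl2_f * sl2_e + cst 2 \<bullet> sl2_h) d i k"
    by cases (simp_all add: times_mfam.rep_eq entry_simps generator_entries
      mmul_jplus_jminus mmul_jminus_jplus jz_def of_nat_diff field_simps)
qed

lemma sl2_h_mult_e: "sl2_h * sl2_e = sl2_e * sl2_h + sl2_e"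
proof (rule mfam_eqI)
  fix d i k :: nat assume "i < d" "k < d"
  moreover have "k = Suc i \<or> jplus d i k = 0" by (auto simp: jplus_def)
  ultimately show "entry (sl2_h * sl2_e) d i k = entry (sl2_e * sl2_h + sl2_e) d i k"
    by (auto simp: times_mfam.rep_eq entry_simps generator_entries mmul_jz_left mmul_jz_right
        jz_def field_simps)
qed

lemma sl2_f_mult_h: "sl2_f * sl2_h = sl2_h * sl2_f + sl2_f"
proof (rule mfam_eqI)
  fix d i k :: nat assume "i < d" "k < d"
  moreover have "i = Suc k \<or> jminus d i k = 0" by (auto simp: jminus_def jplus_def)
  ultimately show "entry (sl2_f * sl2_h) d i k = entry (sl2_h * sl2_f + sl2_f) d i k"
    by (auto simp: times_mfam.rep_eq entry_simps generator_entries mmul_jz_left mmul_jz_right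
        jz_def field_simps)
qed

lemma casimir_efh: "sl2_h * sl2_h + sl2_f * sl2_e + sl2_h = cas \<bullet> 1"
proof (rule mfam_eqI)
  fix d i k :: nat assume "i < d" "k < d"
  then show "entry (sl2_h * sl2_h + sl2_f * sl2_e + sl2_h) d i k = entry (cas \<bullet> 1) d i k"
    by (cases "i = k")
      (simp_all add: times_mfam.rep_eq entry_simps generator_entries one_mfam.rep_eq mid_def
        mmul_jminus_jplus mmul_jz_left casimir_val_def jz_def of_nat_diff field_simps
        power2_eq_square)
qed

lemma casimir_ef: "sl2_h * sl2_h + sl2_e * sl2_f - sl2_h = cas \<bullet> 1"
  unfolding casimir_efh[symmetric] sl2_e_mult_f by (rule mfam_eqI) (simp add: entry_simps)

lemma sl2_x_simps:
  "sl2_x 1 = cst (1/2) \<bullet> (sl2_e + sl2_f)"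
  "sl2_x 2 = cst (- \<i>/2) \<bullet> (sl2_e - sl2_f)"
  "sl2_x 3 = sl2_h"
  by (rule mfam_eqI; simp add: entry_simps generator_entries xgen_def field_simps)+

lemma sl2_efh_eq_x:
  "sl2_e = sl2_x 1 + cst \<i> \<bullet> sl2_x 2"
  "sl2_f = sl2_x 1 - cst \<i> \<bullet> sl2_x 2"
  "sl2_h = sl2_x 3"
  unfolding sl2_x_simps by (rule mfam_eqI; simp add: entry_simps field_simps)+

lemma sl2_x_cases:
  obtains "sl2_x a = sl2_x 1" | "sl2_x a = sl2_x 2" | "sl2_x a = sl2_x 3"
proof -
  have "sl2_x a = (if a = 1 then sl2_x 1 else if a = 2 then sl2_x 2 else sl2_x 3)"
    by (rule mfam_eqI) (simp add: sl2_x.rep_eq xgen_def)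
  then show thesis using that by presburger
qed

abbreviation colours :: "nat set" where "colours \<equiv> {1, 2, 3}"

lemma sum_colours: "(\<Sum>a\<in>colours. f a) = f 1 + f 2 + (f 3 :: 'a :: comm_monoid_add)"
  by (simp add: add.assoc)

section \<open>The adjoint action and the bridge operator\<close>

interpretation ad: module_hom smul smul "ad g" for g
  by unfold_locales (simp_all add: ad_def algebra_simps mf.scale_right_diff_distrib)

interpretation word_deriv: module_hom smul smul "\<lambda>D. word_deriv f l D w" for f l w
proof (unfold_locales)
  show "word_deriv f l (D + D') w = word_deriv f l D w + word_deriv f l D' w" for D D'
    by (induction w) (auto simp: distrib_left distrib_right)
  show "word_deriv f l (p \<bullet> D) w = p \<bullet> word_deriv f l D w" for p D
    by (induction w) (auto simp: mf.scale_right_distrib)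
qed

lemma ad_f_e: "ad sl2_f sl2_e = - (cst 2 \<bullet> sl2_h)"
  by (simp add: ad_def sl2_e_mult_f)

lemma ad_f_h: "ad sl2_f sl2_h = sl2_f"
  by (simp add: ad_def sl2_f_mult_h)

lemma ad_h_e: "ad sl2_h sl2_e = sl2_e"
  by (simp add: ad_def sl2_h_mult_e)

lemma ad_h_f: "ad sl2_h sl2_f = - sl2_f"
  by (simp add: ad_def sl2_f_mult_h)

lemma sl2_x_commutators:
  "ad (sl2_x 1) (sl2_x 2) = cst \<i> \<bullet> sl2_x 3"
  "ad (sl2_x 2) (sl2_x 3) = cst \<i> \<bullet> sl2_x 1"
  "ad (sl2_x 3) (sl2_x 1) = cst \<i> \<bullet> sl2_x 2"
  unfolding sl2_x_simps
  by (rule mfam_eqI; simp add: ad_def entry_simps distrib_left distrib_right left_diff_distrib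
      right_diff_distrib sl2_e_mult_f sl2_h_mult_e sl2_f_mult_h field_simps)+

definition bridge_op :: "mfam \<Rightarrow> mfam" where
  "bridge_op X = (\<Sum>a\<in>colours. sl2_x a * X * sl2_x a)"

interpretation bridge_op: module_hom smul smul bridge_op
  by unfold_locales
    (simp_all add: bridge_op_def distrib_left distrib_right sum.distrib mf.scale_sum_right
      del: sum.insert)

lemma bridge_op_efh:
  "bridge_op X = cst (1/2) \<bullet> (sl2_e * X * sl2_f + sl2_f * X * sl2_e) + sl2_h * X * sl2_h"
  unfolding bridge_op_def sum_colours sl2_x_simps
  by (intro mfam_eqI) (simp add: entry_simps distrib_left distrib_right
      left_diff_distrib right_diff_distrib field_simps)

text \<open>The bracket on the right is the Casimir element acting through ad.\<close>

lemma bridge_op_eq_ad: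
  "bridge_op X = cas \<bullet> X - cst (1/2) \<bullet> (ad sl2_f (ad sl2_e X) + ad sl2_h (ad sl2_h X) + ad sl2_h X)"
proof -
  have "cas \<bullet> X = (sl2_h * sl2_h + sl2_f * sl2_e + sl2_h) * X"
    by (simp add: casimir_efh)
  moreover have "cas \<bullet> X = X * (sl2_h * sl2_h + sl2_e * sl2_f - sl2_h)"
    by (simp add: casimir_ef)
  moreover have "cas \<bullet> X = cst (1/2) \<bullet> (cas \<bullet> X + cas \<bullet> X)"
    by (rule mfam_eqI) (simp add: entry_simps)
  ultimately have twice: "cas \<bullet> X = cst (1/2) \<bullet> ((sl2_h * sl2_h + sl2_f * sl2_e + sl2_h) * X
      + X * (sl2_h * sl2_h + sl2_e * sl2_f - sl2_h))"
    by simp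
  show ?thesis
    unfolding twice bridge_op_efh
    by (intro mfam_eqI)
      (simp add: ad_def entry_simps algebra_simps add_divide_distrib diff_divide_distrib)
qed

lemma bridge_op_one: "bridge_op 1 = cas \<bullet> 1"
  unfolding bridge_op_eq_ad by (simp add: ad_def)

lemma sum_sl2_x_square: "(\<Sum>a\<in>colours. sl2_x a * sl2_x a) = cas \<bullet> 1"
  using bridge_op_one by (simp add: bridge_op_def)

lemma bridge_op_ad_f: "bridge_op (ad sl2_f X) = ad sl2_f (bridge_op X)"
  unfolding bridge_op_efh ad.add ad.scale ad_mult ad_f_e ad_f_h ad_self
  by (intro mfam_eqI) (simp add: entry_simps distrib_left distrib_right field_simps)

lemma ad_e_e_power: "ad sl2_e (sl2_e ^ k) = 0"
  by (simp add: ad_def power_commutes)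

lemma ad_h_e_power: "ad sl2_h (sl2_e ^ k) = cst (of_nat k) \<bullet> sl2_e ^ k"
proof (induction k)
  case (Suc k)
  then show ?case
    by (intro mfam_eqI) (simp add: ad_mult ad_h_e entry_simps algebra_simps)
qed (simp add: ad_def)

lemma ad_f_e_power_Suc:
  "ad sl2_f (sl2_e ^ Suc k) =
    cst (of_nat (Suc k)) \<bullet> (cst (of_nat k) \<bullet> sl2_e ^ k - cst 2 \<bullet> (sl2_h * sl2_e ^ k))"
proof (induction k)
  case 0
  show ?case by (simp add: ad_f_e)
next
  case (Suc k)
  have e_mult_h: "sl2_e * (sl2_h * sl2_e ^ k) = sl2_h * sl2_e ^ Suc k - sl2_e ^ Suc k"
    by (simp add: sl2_h_mult_e distrib_right flip: mult.assoc)
  have "ad sl2_f (sl2_e ^ Suc (Suc k)) =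
      - (cst 2 \<bullet> (sl2_h * sl2_e ^ Suc k)) + sl2_e * ad sl2_f (sl2_e ^ Suc k)"
    by (simp add: ad_mult[of sl2_f sl2_e] ad_f_e)
  also have "\<dots> = - (cst 2 \<bullet> (sl2_h * sl2_e ^ Suc k)) + cst (of_nat (Suc k)) \<bullet>
      (cst (of_nat k) \<bullet> sl2_e ^ Suc k - cst 2 \<bullet> (sl2_h * sl2_e ^ Suc k - sl2_e ^ Suc k))"
    unfolding Suc by (simp only: smul_mult_right right_diff_distrib e_mult_h power_Suc)
  also have "\<dots> = cst (of_nat (Suc (Suc k))) \<bullet>
      (cst (of_nat (Suc k)) \<bullet> sl2_e ^ Suc k - cst 2 \<bullet> (sl2_h * sl2_e ^ Suc k))"
    by (rule mfam_eqI) (simp add: entry_simps algebra_simps)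
  finally show ?case .
qed

definition bridge_eigval :: "nat \<Rightarrow> complex poly" where
  "bridge_eigval l = cas - cst (of_nat (l * (l + 1)) / 2)"

lemma bridge_op_e_power: "bridge_op (sl2_e ^ l) = bridge_eigval l \<bullet> sl2_e ^ l"
  unfolding bridge_op_eq_ad ad_e_e_power ad_h_e_power ad.scale bridge_eigval_def
  by (intro mfam_eqI) (simp add: entry_simps field_simps)

lemma entry_e_power_nonzero: "i + k < d \<Longrightarrow> entry (sl2_e ^ k) d i (i + k) \<noteq> 0"
proof (induction k arbitrary: i)
  case 0
  then show ?case by (simp add: one_mfam.rep_eq mid_def)
next
  case (Suc k)
  have "entry (sl2_e ^ Suc k) d i (i + Suc k) =
      (\<Sum>j<d. if j = Suc i then jplus d i (Suc i) * entry (sl2_e ^ k) d (Suc i) (Suc i + k) else 0)"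
    unfolding power_Suc times_mfam.rep_eq mmul_def sl2_e.rep_eq
    by (rule sum.cong) (auto simp: jplus_def)
  also have "\<dots> = jplus d i (Suc i) * entry (sl2_e ^ k) d (Suc i) (Suc i + k)"
    using Suc.prems by simp
  finally show ?case using Suc.IH[of "Suc i"] Suc.prems by (simp add: jplus_def)
qed

section \<open>Harmonic elements\<close>

definition harmonics :: "nat \<Rightarrow> mfam set" where
  "harmonics n = {(ad sl2_f ^^ j) (sl2_e ^ l) | j l. l \<le> n}"

lemma span_harmonics_mono: "m \<le> n \<Longrightarrow> mf.span (harmonics m) \<subseteq> mf.span (harmonics n)"
  by (rule mf.span_mono) (force simp: harmonics_def)

lemma e_power_in_span_harmonics: "l \<le> n \<Longrightarrow> sl2_e ^ l \<in> mf.span (harmonics n)"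
  unfolding harmonics_def by (rule mf.span_base) (force intro: exI[of _ 0])

lemma ad_f_span_harmonics:
  assumes "X \<in> mf.span (harmonics n)"
  shows "ad sl2_f X \<in> mf.span (harmonics n)"
proof -
  have "ad sl2_f ((ad sl2_f ^^ j) (sl2_e ^ l)) = (ad sl2_f ^^ Suc j) (sl2_e ^ l)" for j l
    by simp
  then have "ad sl2_f ` harmonics n \<subseteq> harmonics n"
    unfolding harmonics_def by blast
  then have "ad sl2_f ` mf.span (harmonics n) \<subseteq> mf.span (harmonics n)"
    by (metis ad.span_image mf.span_mono)
  then show ?thesis using assms by blast
qed

lemma h_mult_e_power_in_span_harmonics:
  "sl2_h * sl2_e ^ l \<in> mf.span (harmonics (Suc l))"
proof -
  have "sl2_h * sl2_e ^ l =
      cst (of_nat l / 2) \<bullet> sl2_e ^ l - cst (1 / (2 * of_nat (Suc l))) \<bullet> ad sl2_f (sl2_e ^ Suc l)"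
    unfolding ad_f_e_power_Suc
    by (intro mfam_eqI) (simp add: entry_simps field_simps del: of_nat_Suc)
  then show ?thesis
    by (auto intro!: mf.span_diff mf.span_scale e_power_in_span_harmonics ad_f_span_harmonics
        simp del: power_Suc)
qed

lemma ad_f_h_mult_e_power_Suc:
  "ad sl2_f (sl2_h * sl2_e ^ Suc l) = cst (2 * of_nat l + 3) \<bullet> (sl2_f * sl2_e ^ Suc l)
     - cst (2 * of_nat (Suc l)) \<bullet> cas \<bullet> sl2_e ^ l
     + cst (of_nat (Suc l) * of_nat (Suc (Suc l))) \<bullet> (sl2_h * sl2_e ^ l)"
proof -
  have "cas \<bullet> sl2_e ^ l = (sl2_h * sl2_h + sl2_f * sl2_e + sl2_h) * sl2_e ^ l"
    by (simp add: casimir_efh)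
  then have h_square: "sl2_h * (sl2_h * sl2_e ^ l) =
      cas \<bullet> sl2_e ^ l - sl2_f * sl2_e ^ Suc l - sl2_h * sl2_e ^ l"
    by (simp add: distrib_right mult.assoc)
  have "ad sl2_f (sl2_h * sl2_e ^ Suc l) = sl2_f * sl2_e ^ Suc l + cst (of_nat (Suc l)) \<bullet>
      (cst (of_nat l) \<bullet> (sl2_h * sl2_e ^ l)
        - cst 2 \<bullet> (cas \<bullet> sl2_e ^ l - sl2_f * sl2_e ^ Suc l - sl2_h * sl2_e ^ l))"
    unfolding ad_mult[of sl2_f sl2_h] ad_f_h ad_f_e_power_Suc
    by (simp only: smul_mult_right right_diff_distrib h_square)
  also have "\<dots> = cst (2 * of_nat l + 3) \<bullet> (sl2_f * sl2_e ^ Suc l)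
     - cst (2 * of_nat (Suc l)) \<bullet> cas \<bullet> sl2_e ^ l
     + cst (of_nat (Suc l) * of_nat (Suc (Suc l))) \<bullet> (sl2_h * sl2_e ^ l)"
    by (rule mfam_eqI) (simp add: entry_simps algebra_simps)
  finally show ?thesis .
qed

lemma f_mult_e_power_in_span_harmonics:
  "sl2_f * sl2_e ^ l \<in> mf.span (harmonics (Suc l))"
proof (cases l)
  case 0
  have "sl2_f = ad sl2_f (sl2_h * sl2_e ^ 0)" by (simp add: ad_f_h)
  then show ?thesis
    unfolding 0 using ad_f_span_harmonics[OF h_mult_e_power_in_span_harmonics[of 0]] by simp
next
  case (Suc m)
  have nonzero: "2 * of_nat m + (3 :: complex) \<noteq> 0"
    using of_nat_neq_0[of "2 * m + 2", where 'a = complex] by (simp add: add.commute)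
  have "sl2_f * sl2_e ^ l = cst (1 / (2 * of_nat m + 3)) \<bullet>
      (ad sl2_f (sl2_h * sl2_e ^ l) + cst (2 * of_nat l) \<bullet> cas \<bullet> sl2_e ^ m
        - cst (of_nat l * of_nat (Suc l)) \<bullet> (sl2_h * sl2_e ^ m))"
    unfolding Suc ad_f_h_mult_e_power_Suc using nonzero
    by (intro mfam_eqI) (simp add: entry_simps field_simps)
  moreover have "sl2_e ^ m \<in> mf.span (harmonics (Suc l))"
    "sl2_h * sl2_e ^ m \<in> mf.span (harmonics (Suc l))"
    using e_power_in_span_harmonics[of m "Suc l"] h_mult_e_power_in_span_harmonics[of m]
      span_harmonics_mono[of "Suc m" "Suc l"] Suc by auto
  ultimately show ?thesis
    using ad_f_span_harmonics[OF h_mult_e_power_in_span_harmonics[of l]]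
    by (metis mf.span_add mf.span_diff mf.span_scale)
qed

lemma efh_mult_span_harmonics:
  assumes "X \<in> mf.span (harmonics n)"
  shows "sl2_e * X \<in> mf.span (harmonics (Suc n)) \<and> sl2_h * X \<in> mf.span (harmonics (Suc n))
    \<and> sl2_f * X \<in> mf.span (harmonics (Suc n))" (is "?P X")
  using assms
proof (induction rule: mf.span_induct)
  case base
  show ?case
    by (rule mf.subspaceI)
      (auto simp: distrib_left intro: mf.span_add mf.span_scale mf.span_zero)
next
  case (step X)
  then obtain j l where X: "X = (ad sl2_f ^^ j) (sl2_e ^ l)" and "l \<le> n"
    by (auto simp: harmonics_def)
  show ?case unfolding X
  proof (induction j)
    case 0
    show ?case
      using h_mult_e_power_in_span_harmonics[of l] f_mult_e_power_in_span_harmonics[of l]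
        e_power_in_span_harmonics[of "Suc l" "Suc n"] span_harmonics_mono[of "Suc l" "Suc n"]
        \<open>l \<le> n\<close>
      by auto
  next
    case (Suc j)
    define Y where "Y = (ad sl2_f ^^ j) (sl2_e ^ l)"
    have swap: "g * ad sl2_f Y = ad sl2_f (g * Y) - ad sl2_f g * Y" for g
      by (simp add: ad_mult)
    have "?P Y" using Suc by (simp add: Y_def)
    then have "?P (ad sl2_f Y)"
      unfolding swap ad_f_e ad_f_h ad_self
      by (auto intro!: mf.span_add mf.span_diff ad_f_span_harmonics mf.span_neg mf.span_scale
          mf.span_zero)
    then show ?case by (simp add: Y_def)
  qed
qed

lemma sl2_x_mult_span_harmonics:
  assumes "X \<in> mf.span (harmonics n)"
  shows "sl2_x a * X \<in> mf.span (harmonics (Suc n))"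
  using efh_mult_span_harmonics[OF assms]
  by (cases rule: sl2_x_cases[of a])
    (simp_all only: sl2_x_simps smul_mult_left distrib_right left_diff_distrib
      mf.span_add mf.span_diff mf.span_scale)

definition xprod :: "nat list \<Rightarrow> mfam" where
  "xprod w = prod_list (map sl2_x w)"

lemma xprod_simps [simp]:
  "xprod [] = 1" "xprod (a # w) = sl2_x a * xprod w" "xprod (w @ w') = xprod w * xprod w'"
  by (simp_all add: xprod_def)

lemma xprod_in_span_harmonics: "xprod w \<in> mf.span (harmonics (length w))"
proof (induction w)
  case Nil
  show ?case using e_power_in_span_harmonics[of 0 0] by simp
qed (simp add: sl2_x_mult_span_harmonics)

definition colour_words :: "nat \<Rightarrow> nat list set" where
  "colour_words n = {w. set w \<subseteq> colours \<and> length w = n}"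

lemma colour_words_0 [simp]: "colour_words 0 = {[]}"
  by (auto simp: colour_words_def)

lemma length_colour_words: "w \<in> colour_words n \<Longrightarrow> length w = n"
  by (simp add: colour_words_def)

lemma sum_colour_words_Suc:
  "(\<Sum>w\<in>colour_words (Suc n). F w) = (\<Sum>a\<in>colours. \<Sum>w\<in>colour_words n. F (a # w))"
proof -
  have "inj_on (\<lambda>(w, a). a # w) (colour_words n \<times> colours)" by (auto simp: inj_on_def)
  then have "(\<Sum>w\<in>colour_words (Suc n). F w) = (\<Sum>(w, a)\<in>colour_words n \<times> colours. F (a # w))"
    unfolding colour_words_def lists_length_Suc_eq by (simp add: sum.reindex case_prod_unfold)
  also have "\<dots> = (\<Sum>w\<in>colour_words n. \<Sum>a\<in>colours. F (a # w))"
    by (simp only: sum.cartesian_product)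
  finally show ?thesis by (subst sum.swap)
qed

lemma e_power_in_span_xprod: "sl2_e ^ n \<in> mf.span (xprod ` colour_words n)"
proof (induction n)
  case 0
  have "1 = xprod []" by simp
  then show ?case by (intro mf.span_base) auto
next
  case (Suc n)
  have "sl2_x a * X \<in> mf.span (xprod ` colour_words (Suc n))"
      if "X \<in> mf.span (xprod ` colour_words n)" "a \<in> colours" for a X
    using that(1)
  proof (induction rule: mf.span_induct)
    case base
    show ?case
      by (rule mf.subspaceI) (auto simp: distrib_left intro: mf.span_add mf.span_scale mf.span_zero)
  next
    case (step X)
    then obtain w where "w \<in> colour_words n" "X = xprod w" by auto
    then have "sl2_x a * X = xprod (a # w)" "a # w \<in> colour_words (Suc n)"
      using \<open>a \<in> colours\<close> by (auto simp: colour_words_def)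
    then show ?case by (blast intro: mf.span_base)
  qed
  moreover have "sl2_e ^ Suc n = sl2_x 1 * sl2_e ^ n + cst \<i> \<bullet> (sl2_x 2 * sl2_e ^ n)"
    by (subst power_Suc, subst (1) sl2_efh_eq_x(1)) (simp add: distrib_right)
  ultimately show ?case
    using Suc by (auto intro: mf.span_add mf.span_scale simp del: power_Suc)
qed

section \<open>Equivariant operators\<close>

lemma ad_linear_left:
  "ad (g + p \<bullet> g') X = ad g X + p \<bullet> ad g' X" "ad (g - p \<bullet> g') X = ad g X - p \<bullet> ad g' X"
  by (simp_all add: ad_def distrib_left distrib_right left_diff_distrib right_diff_distrib
      mf.scale_right_diff_distrib)

locale sl2_equivariant = module_hom smul smul T for T :: "mfam \<Rightarrow> mfam" +
  assumes ad_x: "T (ad (sl2_x a) X) = ad (sl2_x a) (T X)"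
begin

lemma ad_efh:
  "T (ad sl2_e X) = ad sl2_e (T X)"
  "T (ad sl2_f X) = ad sl2_f (T X)"
  "T (ad sl2_h X) = ad sl2_h (T X)"
  by (simp_all only: sl2_efh_eq_x ad_linear_left add diff scale ad_x)

lemma bridge_op_commute: "T (bridge_op X) = bridge_op (T X)"
  by (simp only: bridge_op_eq_ad ad_efh add diff scale)

end

lemma sl2_equivariant_eq_on_span_harmonics:
  assumes "sl2_equivariant T" "sl2_equivariant T'"
    and "\<And>l. l \<le> n \<Longrightarrow> T (sl2_e ^ l) = T' (sl2_e ^ l)" "X \<in> mf.span (harmonics n)"
  shows "T X = T' X"
proof -
  interpret T: sl2_equivariant T by fact
  interpret T': sl2_equivariant T' by fact
  interpret module_pair smul smul
    by (intro module_pair.intro mf.module_axioms)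
  have "T ((ad sl2_f ^^ j) (sl2_e ^ l)) = T' ((ad sl2_f ^^ j) (sl2_e ^ l))" if "l \<le> n" for j l
  proof (induction j)
    case (Suc j)
    then show ?case by (simp add: T.ad_efh T'.ad_efh)
  qed (simp add: assms(3) that)
  then have "T b = T' b" if "b \<in> harmonics n" for b
    using that by (auto simp: harmonics_def)
  from module_hom_eq_on_span[OF T.module_hom_axioms T'.module_hom_axioms this assms(4)]
  show ?thesis .
qed

text \<open>Schur's lemma. The bridge operator separates the spins and ad h the weights, with real
  differences between eigenvalues. With the factor i these cannot cancel in the sum, which therefore
  has pairwise different eigenvalues on the harmonics (ad f)^j e^l.\<close>

definition spin_weight_op :: "mfam \<Rightarrow> mfam" where
  "spin_weight_op X = bridge_op X + cst \<i> \<bullet> ad sl2_h X"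

definition spin_weight :: "nat \<Rightarrow> nat \<Rightarrow> complex poly" where
  "spin_weight j l = bridge_eigval l + cst (\<i> * (of_nat l - of_nat j))"

interpretation spin_weight_op: module_hom smul smul spin_weight_op
  by unfold_locales
    (simp_all add: spin_weight_op_def ad.add ad.scale bridge_op.add bridge_op.scale
        mf.scale_right_distrib mult.commute)

lemma spin_weight_op_harmonic:
  "spin_weight_op ((ad sl2_f ^^ j) (sl2_e ^ l)) = spin_weight j l \<bullet> (ad sl2_f ^^ j) (sl2_e ^ l)"
proof -
  let ?v = "\<lambda>j. (ad sl2_f ^^ j) (sl2_e ^ l)"
  have "bridge_op (?v j) = bridge_eigval l \<bullet> ?v j"
    by (induction j) (simp_all add: bridge_op_e_power bridge_op_ad_f ad.scale)
  moreover have "ad sl2_h (?v j) = cst (of_nat l - of_nat j) \<bullet> ?v j"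
  proof (induction j)
    case (Suc j)
    have commute: "ad sl2_h (ad sl2_f Y) = ad sl2_f (ad sl2_h Y) - ad sl2_f Y" for Y
    proof -
      have "ad sl2_h (ad sl2_f Y) = ad sl2_f (ad sl2_h Y) + ad (ad sl2_h sl2_f) Y"
        by (simp add: ad_def algebra_simps)
      then show ?thesis by (simp add: ad_h_f) (simp add: ad_def)
    qed
    have "ad sl2_h (?v (Suc j)) = cst (of_nat l - of_nat j) \<bullet> ad sl2_f (?v j) - ad sl2_f (?v j)"
      by (simp add: commute Suc ad.scale)
    also have "\<dots> = cst (of_nat l - of_nat (Suc j)) \<bullet> ?v (Suc j)"
      by (rule mfam_eqI) (simp add: entry_simps algebra_simps)
    finally show ?case .
  qed (simp add: ad_h_e_power)
  ultimately show ?thesis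
    by (simp add: spin_weight_op_def spin_weight_def mf.scale_left_distrib mult.commute)
qed

lemma spin_weight_diff_unit:
  assumes "(j, l) \<noteq> (0, k)"
  shows "spin_weight 0 k - spin_weight j l dvd 1"
proof -
  let ?z =
    "(of_nat (l * (l + 1)) - of_nat (k * (k + 1))) / 2 + \<i> * (of_nat k - of_nat l + of_nat j)"
  have "?z \<noteq> 0"
  proof
    assume "?z = 0"
    then have "Re ?z = 0" "Im ?z = 0" by (metis zero_complex.sel)+
    then have "real (l * (l + 1)) = real (k * (k + 1))" and weights: "real k - real l + real j = 0"
      by simp_all
    then have "l = k" using pronic_eq_iff by (simp only: of_nat_eq_iff)
    with weights assms show False by simp
  qed
  moreover have "spin_weight 0 k - spin_weight j l = cst ?z"
    by (simp add: spin_weight_def bridge_eigval_def field_simps)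
  ultimately show ?thesis using is_unit_cst by metis
qed

lemma (in sl2_equivariant) e_power_eigenvector:
  assumes "T (sl2_e ^ l) \<in> mf.span (harmonics n)"
  obtains p where "T (sl2_e ^ l) = p \<bullet> sl2_e ^ l"
proof -
  obtain B r where expansion: "finite B" "B \<subseteq> harmonics n" "T (sl2_e ^ l) = (\<Sum>b\<in>B. r b \<bullet> b)"
    using assms by (auto simp: mf.span_explicit)
  define p where "p = (if sl2_e ^ l \<in> B then r (sl2_e ^ l) else 0)"
  let ?B = "B - {sl2_e ^ l}"
  have "\<exists>m. spin_weight_op b = m \<bullet> b \<and> spin_weight 0 l - m dvd 1" if b: "b \<in> ?B" for b
  proof -
    obtain j i where "b = (ad sl2_f ^^ j) (sl2_e ^ i)" 
      using b expansion(2) by (auto simp: harmonics_def)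
    moreover from this b have "(j, i) \<noteq> (0, l)" by auto
    ultimately show ?thesis using spin_weight_op_harmonic spin_weight_diff_unit by blast
  qed
  then obtain m where eigenvalues: "\<And>b. b \<in> ?B \<Longrightarrow> spin_weight_op b = m b \<bullet> b"
    "\<And>b. b \<in> ?B \<Longrightarrow> spin_weight 0 l - m b dvd 1" by metis
  define x where "x = T (sl2_e ^ l) - p \<bullet> sl2_e ^ l"
  have "x = (\<Sum>b\<in>?B. r b \<bullet> b)"
    using expansion(1,3) by (auto simp: x_def p_def sum.remove)
  moreover have "spin_weight_op x = spin_weight 0 l \<bullet> x"
  proof -
    have "spin_weight_op (sl2_e ^ l) = spin_weight 0 l \<bullet> sl2_e ^ l"
      using spin_weight_op_harmonic[of 0 l] by simp
    moreover have "spin_weight_op (T (sl2_e ^ l)) = T (spin_weight_op (sl2_e ^ l))"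
      by (simp add: spin_weight_op_def add scale ad_efh bridge_op_commute)
    ultimately show ?thesis
      by (simp add: x_def spin_weight_op.diff spin_weight_op.scale scale
          mf.scale_right_diff_distrib mult.commute)
  qed
  ultimately have "x = 0"
    using eigenvalues expansion(1)
    by (intro mf.sum_eigenvectors_eq_0[of spin_weight_op ?B x "\<lambda>b. r b \<bullet> b" _ m])
      (simp_all add: spin_weight_op.module_hom_axioms spin_weight_op.scale mult.commute)
  then show thesis by (intro that[of p]) (simp add: x_def)
qed

section \<open>Shares as operators\<close>

definition labels :: "share \<Rightarrow> nat set" where
  "labels s = set (fst s) \<union> set (snd s)"

definition share_eval :: "(mfam \<Rightarrow> mfam \<Rightarrow> mfam) \<Rightarrow> share \<Rightarrow> mfam" where
  "share_eval F s = (\<Sum>\<phi>\<in>labels s \<rightarrow>\<^sub>E colours. F (xprod (map \<phi> (fst s))) (xprod (map \<phi> (snd s))))"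

abbreviation share_op :: "share \<Rightarrow> mfam \<Rightarrow> mfam" where
  "share_op s X \<equiv> share_eval (\<lambda>u v. u * X * v) s"

lemma share_op_module_hom: "module_hom smul smul (share_op s)"
  by unfold_locales
    (simp_all add: share_eval_def distrib_left distrib_right sum.distrib mf.scale_sum_right)

text \<open>The matrix X between the strands is treated as one more letter, with label None.\<close>

definition share_word :: "share \<Rightarrow> nat option list" where
  "share_word s = map Some (fst s) @ None # map Some (snd s)"

definition share_letters :: "(nat \<Rightarrow> nat) \<Rightarrow> mfam \<Rightarrow> nat option \<Rightarrow> mfam" where
  "share_letters \<phi> X = case_option X (\<lambda>l. sl2_x (\<phi> l))"

lemma share_letters_fun_upd:
  "(share_letters \<phi> X)(None := Z) = share_letters \<phi> Z"
  "(share_letters \<phi> X)(Some l := sl2_x a) = share_letters (\<phi>(l := a)) X"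
  by (auto simp: share_letters_def fun_eq_iff split: option.split)

lemma share_op_eq_prod_list:
  "share_op s X = (\<Sum>\<phi>\<in>labels s \<rightarrow>\<^sub>E colours. prod_list (map (share_letters \<phi> X) (share_word s)))"
  unfolding share_eval_def
  by (simp add: share_letters_def share_word_def xprod_def comp_def mult.assoc)

text \<open>The tensor of a chord is invariant because the structure constants are antisymmetric.\<close>

lemma sum_chord_ad_eq_0:
  assumes "\<And>A. module_hom smul smul (B A)" "\<And>A A'. B A A' = B A' A"
  shows "(\<Sum>a\<in>colours. B (sl2_x a) (ad (sl2_x t) (sl2_x a))) = 0"
proof -
  interpret B: module_hom smul smul "B A" for A by (fact assms(1))
  have reverse: "ad (sl2_x 2) (sl2_x 1) = - (cst \<i> \<bullet> sl2_x 3)"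
    "ad (sl2_x 3) (sl2_x 2) = - (cst \<i> \<bullet> sl2_x 1)"
    "ad (sl2_x 1) (sl2_x 3) = - (cst \<i> \<bullet> sl2_x 2)"
    by (simp_all only: ad_swap[of "sl2_x 2" "sl2_x 1"] ad_swap[of "sl2_x 3" "sl2_x 2"]
        ad_swap[of "sl2_x 1" "sl2_x 3"] sl2_x_commutators)
  have "B (sl2_x 2) (sl2_x 1) = B (sl2_x 1) (sl2_x 2)"
    "B (sl2_x 3) (sl2_x 2) = B (sl2_x 2) (sl2_x 3)"
    "B (sl2_x 3) (sl2_x 1) = B (sl2_x 1) (sl2_x 3)"
    by (rule assms(2))+
  then show ?thesis
    unfolding sum_colours
    by (cases rule: sl2_x_cases[of t])
      (simp_all only: ad_self sl2_x_commutators reverse B.neg B.scale B.zero, simp_all)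
qed

lemma sum_word_deriv_label_eq_0:
  assumes "wf_share s" "l \<in> labels s"
  shows "(\<Sum>\<phi>\<in>labels s \<rightarrow>\<^sub>E colours.
    word_deriv (share_letters \<phi> X) (Some l) (ad (sl2_x t) (sl2_x (\<phi> l))) (share_word s)) = 0"
proof -
  have "count_list (share_word s) (Some l) = count_list (fst s @ snd s) l"
    by (simp add: share_word_def count_list_map_conv)
  then have twice: "count_list (share_word s) (Some l) = 2"
    using assms by (auto simp: wf_share_def labels_def)
  let ?B = "\<lambda>\<phi> A D. word_deriv ((share_letters \<phi> X)(Some l := A)) (Some l) D (share_word s)"
  have "(\<Sum>a\<in>colours. ?B \<phi> (sl2_x a) (ad (sl2_x t) (sl2_x a))) = 0" for \<phi>
    by (rule sum_chord_ad_eq_0)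
      (fact word_deriv.module_hom_axioms word_deriv_twice_commute[OF twice])+
  then have "(\<Sum>\<phi>\<in>insert l (labels s - {l}) \<rightarrow>\<^sub>E colours.
      word_deriv (share_letters \<phi> X) (Some l) (ad (sl2_x t) (sl2_x (\<phi> l))) (share_word s)) = 0"
    by (subst sum_PiE_insert)
      (simp_all add: share_letters_fun_upd del: fun_upd_apply add: fun_upd_same)
  then show ?thesis using assms(2) by (simp add: insert_absorb)
qed

lemma share_op_equivariant:
  assumes "wf_share s"
  shows "sl2_equivariant (share_op s)"
proof -
  interpret module_hom smul smul "share_op s" by (rule share_op_module_hom)
  have "share_op s (ad (sl2_x t) X) = ad (sl2_x t) (share_op s X)" for t X
  proof -
    let ?w = "share_word s" and ?f = "\<lambda>\<phi>. share_letters \<phi> X" and ?C = "labels s \<rightarrow>\<^sub>E colours"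
    have letters: "?f \<phi> None = X" "?f \<phi> (Some l) = sl2_x (\<phi> l)" for \<phi> l
      by (simp_all add: share_letters_def)
    have "ad (sl2_x t) (prod_list (map (?f \<phi>) ?w)) =
        (\<Sum>k\<in>insert None (Some ` labels s). word_deriv (?f \<phi>) k (ad (sl2_x t) (?f \<phi> k)) ?w)" for \<phi>
      by (rule ad_prod_list) (auto simp: share_word_def labels_def)
    also have "\<dots> \<phi> = word_deriv (?f \<phi>) None (ad (sl2_x t) X) ?w
        + (\<Sum>l\<in>labels s. word_deriv (?f \<phi>) (Some l) (ad (sl2_x t) (sl2_x (\<phi> l))) ?w)" for \<phi>
      by (subst sum.insert) (auto simp: labels_def sum.reindex letters)
    finally have "ad (sl2_x t) (share_op s X) = (\<Sum>\<phi>\<in>?C. word_deriv (?f \<phi>) None (ad (sl2_x t) X) ?w)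
        + (\<Sum>l\<in>labels s. \<Sum>\<phi>\<in>?C. word_deriv (?f \<phi>) (Some l) (ad (sl2_x t) (sl2_x (\<phi> l))) ?w)"
      by (simp add: share_op_eq_prod_list ad.sum sum.distrib) (rule sum.swap)
    also have "(\<Sum>l\<in>labels s. \<Sum>\<phi>\<in>?C. word_deriv (?f \<phi>) (Some l) (ad (sl2_x t) (sl2_x (\<phi> l))) ?w) = 0"
      by (intro sum.neutral ballI sum_word_deriv_label_eq_0 assms)
    also have "(\<Sum>\<phi>\<in>?C. word_deriv (?f \<phi>) None (ad (sl2_x t) X) ?w) = share_op s (ad (sl2_x t) X)"
      unfolding share_op_eq_prod_list
      by (intro sum.cong refl, subst word_deriv_once)
        (auto simp: share_word_def count_list_0_iff share_letters_fun_upd)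
    finally show ?thesis by simp
  qed
  then show ?thesis by unfold_locales
qed

lemma share_op_e_power_in_span_harmonics:
  "\<exists>n. share_op s (sl2_e ^ l) \<in> mf.span (harmonics n)"
proof -
  have e_power_mult: "sl2_e ^ l * X \<in> mf.span (harmonics (l + n))"
      if "X \<in> mf.span (harmonics n)" for X n
    by (induction l) (simp_all add: that efh_mult_span_harmonics mult.assoc)
  have xprod_mult: "xprod w * X \<in> mf.span (harmonics (length w + n))"
      if "X \<in> mf.span (harmonics n)" for w X n
    by (induction w) (simp_all add: that sl2_x_mult_span_harmonics mult.assoc)
  have "xprod u * sl2_e ^ l * xprod v \<in> mf.span (harmonics (length u + (l + length v)))" for u v
    unfolding mult.assoc by (intro xprod_mult e_power_mult xprod_in_span_harmonics)
  then have "share_op s (sl2_e ^ l) \<in> mf.span (harmonics (length (fst s) + (l + length (snd s))))"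
    unfolding share_eval_def by (intro mf.span_sum) (metis length_map)
  then show ?thesis ..
qed

lemma inj_lab: "inj lab1" "inj lab2" "range lab1 \<inter> range lab2 = {}"
  by (auto simp: lab1_def lab2_def inj_def) presburger

lemma sum_lab_colourings:
  assumes "L = lab1 ` labels s \<union> lab2 ` labels t"
  shows "(\<Sum>\<phi>\<in>L \<rightarrow>\<^sub>E colours. F (\<phi> \<circ> lab1) (\<phi> \<circ> lab2)) =
    (\<Sum>\<alpha>\<in>labels s \<rightarrow>\<^sub>E colours. \<Sum>\<beta>\<in>labels t \<rightarrow>\<^sub>E colours. F \<alpha> \<beta>)"
  unfolding assms by (rule sum_PiE_disjoint_images[OF inj_lab])

lemma share_eval_cross:
  "share_eval F (cross_share s t) = share_eval (\<lambda>u v. share_eval (\<lambda>u' v'. F (u * u') (v' * v)) t) s"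
proof -
  have "labels (cross_share s t) = lab1 ` labels s \<union> lab2 ` labels t"
    by (auto simp: labels_def cross_share_def)
  note sum_lab_colourings[OF this,
      of "\<lambda>\<alpha> \<beta>. F (xprod (map \<alpha> (fst s)) * xprod (map \<beta> (fst t)))
        (xprod (map \<beta> (snd t)) * xprod (map \<alpha> (snd s)))"]
  then show ?thesis
    by (simp add: share_eval_def cross_share_def)
qed

definition word_sum :: "nat list \<Rightarrow> mfam" where
  "word_sum w = (\<Sum>\<phi>\<in>set w \<rightarrow>\<^sub>E colours. xprod (map \<phi> w))"

lemma word_sum_join:
  "word_sum (join_share s t) = share_eval (\<lambda>u v. share_eval (\<lambda>u' v'. u * u' * v * v') t) s"
proof -
  have "set (join_share s t) = lab1 ` labels s \<union> lab2 ` labels t"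
    by (auto simp: labels_def join_share_def)
  note sum_lab_colourings[OF this,
      of "\<lambda>\<alpha> \<beta>. xprod (map \<alpha> (fst s)) * xprod (map \<beta> (fst t)) * xprod (map \<alpha> (snd s)) *
        xprod (map \<beta> (snd t))"]
  then show ?thesis
    by (simp add: word_sum_def share_eval_def join_share_def mult.assoc)
qed

lemma entry_xprod: "entry (xprod (map \<phi> w)) d = wordmat d \<phi> w"
  by (induction w) (simp_all add: wordmat_def one_mfam.rep_eq times_mfam.rep_eq sl2_x.rep_eq)

lemma entry_word_sum: "entry (word_sum w) d i k = sl2sum d w i k"
  by (simp only: word_sum_def entry_sum entry_xprod sl2sum_def)

lemma word_sum_eq_w_sl2:
  assumes "\<And>l. l \<in> set w \<Longrightarrow> count_list w l = 2"
  shows "word_sum w = w_sl2 w \<bullet> 1"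
proof -
  interpret sl2_equivariant "share_op (w, [])"
    using assms by (intro share_op_equivariant) (simp add: wf_share_def)
  have word_sum: "word_sum w = share_op (w, []) (sl2_e ^ 0)"
    by (simp add: word_sum_def share_eval_def labels_def)
  obtain p where scalar: "word_sum w = p \<bullet> 1"
    using share_op_e_power_in_span_harmonics[of 0 "(w, [])"] e_power_eigenvector[of 0]
    unfolding word_sum by auto
  have "w_sl2 w = p" unfolding w_sl2_def
  proof (rule the_equality)
    show "\<forall>d\<ge>1. \<forall>i<d. \<forall>k<d. sl2sum d w i k = (if i = k then poly p (casimir_val d) else 0)"
      by (simp add: scalar smul.rep_eq one_mfam.rep_eq mid_def flip: entry_word_sum)
  next
    fix q
    assume scalar_q: "\<forall>d\<ge>1. \<forall>i<d. \<forall>k<d.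
      sl2sum d w i k = (if i = k then poly q (casimir_val d) else 0)"
    have "word_sum w = q \<bullet> 1"
      by (rule mfam_eqI) (simp add: scalar_q entry_word_sum smul.rep_eq one_mfam.rep_eq mid_def)
    then show "q = p" using scalar by (simp add: smul_one_eq_iff)
  qed
  then show ?thesis using scalar by simp
qed

section \<open>Combinations of shares\<close>

abbreviation "keys \<equiv> Poly_Mapping.keys"
abbreviation "lookup \<equiv> Poly_Mapping.lookup"

definition a2_eval :: "(mfam \<Rightarrow> mfam \<Rightarrow> mfam) \<Rightarrow> a2 \<Rightarrow> mfam" where
  "a2_eval F I = (\<Sum>s\<in>keys I. cst (lookup I s) \<bullet> share_eval F s)"

lemma a2_eval_superset:
  "finite A \<Longrightarrow> keys I \<subseteq> A \<Longrightarrow> a2_eval F I = (\<Sum>s\<in>A. cst (lookup I s) \<bullet> share_eval F s)"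
  unfolding a2_eval_def by (rule sum.mono_neutral_left) (auto simp: in_keys_iff)

lemma a2_eval_add: "a2_eval F (I + J) = a2_eval F I + a2_eval F J"
proof -
  let ?A = "keys I \<union> keys J"
  have "a2_eval F (I + J) = (\<Sum>s\<in>?A. cst (lookup (I + J) s) \<bullet> share_eval F s)"
    by (rule a2_eval_superset) (auto simp: keys_add)
  also have "\<dots> =
      (\<Sum>s\<in>?A. cst (lookup I s) \<bullet> share_eval F s) + (\<Sum>s\<in>?A. cst (lookup J s) \<bullet> share_eval F s)"
    by (simp add: lookup_add cst_add_smul sum.distrib)
  also have "\<dots> = a2_eval F I + a2_eval F J"
    by (simp add: a2_eval_superset[of ?A])
  finally show ?thesis .
qed

interpretation a2_eval: additive "a2_eval F" for F
  by (rule additive.intro) (rule a2_eval_add)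

lemma a2_eval_single: "a2_eval F (Poly_Mapping.single s a) = cst a \<bullet> share_eval F s"
  by (cases "a = 0") (simp_all add: a2_eval_def)

lemma a2_eval_scale: "a2_eval F (a2_scale a I) = cst a \<bullet> a2_eval F I"
  by (simp add: a2_scale_def a2_eval.sum a2_eval_single a2_eval_def[of _ I] mf.scale_sum_right
      mult.commute)

lemma a2_eval_zero_fun: "a2_eval (\<lambda>u v. 0) I = 0"
  by (simp add: a2_eval_def share_eval_def)

lemma a2_eval_sum_fun: "a2_eval (\<lambda>u v. \<Sum>i\<in>S. F i u v) I = (\<Sum>i\<in>S. a2_eval (F i) I)"
proof -
  have "share_eval (\<lambda>u v. \<Sum>i\<in>S. F i u v) s = (\<Sum>i\<in>S. share_eval (F i) s)" for s
    unfolding share_eval_def by (rule sum.swap)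
  then show ?thesis
    unfolding a2_eval_def by (simp add: mf.scale_sum_right) (rule sum.swap)
qed

lemma a2_eval_module_hom:
  assumes "module_hom smul smul T"
  shows "T (a2_eval F I) = a2_eval (\<lambda>u v. T (F u v)) I"
proof -
  interpret T: module_hom smul smul T by fact
  show ?thesis by (simp add: a2_eval_def share_eval_def T.sum T.scale)
qed

lemma module_hom_mult: "module_hom smul smul (\<lambda>X. A * X * B)"
  by unfold_locales (simp_all add: distrib_left distrib_right)

lemma a2_eval_mult: "A * a2_eval F I * B = a2_eval (\<lambda>u v. A * F u v * B) I"
  by (rule a2_eval_module_hom[OF module_hom_mult])

lemma a2_eval_smul: "p \<bullet> a2_eval F I = a2_eval (\<lambda>u v. p \<bullet> F u v) I"
  by (rule a2_eval_module_hom[OF mf.module_hom_scale_self])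

lemma a2_eval_cong:
  assumes "\<And>s u v. s \<in> keys I \<Longrightarrow> length u = length (fst s) \<Longrightarrow> length v = length (snd s) \<Longrightarrow>
    F (xprod u) (xprod v) = G (xprod u) (xprod v)"
  shows "a2_eval F I = a2_eval G I"
  unfolding a2_eval_def share_eval_def
  by (intro sum.cong refl arg_cong[of _ _ "smul _"]) (simp add: assms)

lemma a2_eval_swap:
  "a2_eval (\<lambda>u v. a2_eval (G u v) H) I = a2_eval (\<lambda>u' v'. a2_eval (\<lambda>u v. G u v u' v') I) H"
  unfolding a2_eval_def[of _ H] share_eval_def
  by (simp only: a2_eval_sum_fun a2_eval_smul[symmetric])

lemma a2_eval_cross:
  "a2_eval F (a2_cross I H) = a2_eval (\<lambda>u v. a2_eval (\<lambda>u' v'. F (u * u') (v' * v)) H) I"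
proof -
  have "share_eval (\<lambda>u v. a2_eval (\<lambda>u' v'. F (u * u') (v' * v)) H) s =
      (\<Sum>t\<in>keys H. cst (lookup H t) \<bullet> share_eval F (cross_share s t))" for s
    unfolding a2_eval_def share_eval_cross unfolding share_eval_def[of _ s]
    by (simp only: mf.scale_sum_right) (rule sum.swap)
  then show ?thesis
    by (simp add: a2_cross_def a2_eval.sum a2_eval_single a2_eval_def[of _ I] mf.scale_sum_right
        mult.commute)
qed

lemma a2_eval_one: "a2_eval F a2_one = F 1 1"
  by (simp add: a2_one_def a2_eval_single share_eval_def labels_def)

lemma a2_eval_bridge: "a2_eval F bridge = (\<Sum>a\<in>colours. F (sl2_x a) (sl2_x a))"
  unfolding bridge_def a2_eval_single share_eval_def labels_def by (simp add: sum_PiE_insert)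

lemma a2_eval_arch: "a2_eval F arch = (\<Sum>a\<in>colours. F (sl2_x a * sl2_x a) 1)"
  unfolding arch_def a2_eval_single share_eval_def labels_def by (simp add: sum_PiE_insert)

definition a2_op :: "a2 \<Rightarrow> mfam \<Rightarrow> mfam" where
  "a2_op I X = a2_eval (\<lambda>u v. u * X * v) I"

interpretation a2_op: additive "\<lambda>I. a2_op I X" for X
  by (rule additive.intro) (simp add: a2_op_def a2_eval_add)

lemma a2_op_cross: "a2_op (a2_cross I H) X = a2_op I (a2_op H X)"
  unfolding a2_op_def a2_eval_cross a2_eval_mult by (simp add: mult.assoc)

lemma a2_op_scale: "a2_op (a2_scale a I) X = cst a \<bullet> a2_op I X"
  by (simp add: a2_op_def a2_eval_scale)

lemma a2_op_one: "a2_op a2_one X = X"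
  by (simp add: a2_op_def a2_eval_one)

lemma a2_op_bridge: "a2_op bridge X = bridge_op X"
  by (simp only: a2_op_def a2_eval_bridge bridge_op_def)

lemma a2_op_arch: "a2_op arch X = cas \<bullet> X"
proof -
  have "a2_op arch X = (\<Sum>a\<in>colours. sl2_x a * sl2_x a) * X"
    by (simp only: a2_op_def a2_eval_arch sum_distrib_right mult_1_right)
  also have "\<dots> = cas \<bullet> X" by (simp only: sum_sl2_x_square) simp
  finally show ?thesis .
qed

lemma a2_op_cpoly: "a2_op (cpoly q) X = q \<bullet> X"
proof -
  have "a2_op (a2_pow arch i) X = cas ^ i \<bullet> X" for i
    by (induction i arbitrary: X) (simp_all add: a2_pow_def a2_op_one a2_op_cross a2_op_arch)
  then have "a2_op (cpoly q) X = (\<Sum>i\<le>degree q. monom (coeff q i) i \<bullet> X)"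
    by (simp add: cpoly_def a2_op.sum a2_op_scale monom_altdef mult.commute)
  also have "\<dots> = q \<bullet> X"
    by (simp add: poly_as_sum_of_monoms flip: mf.scale_sum_left)
  finally show ?thesis .
qed

lemma a2_op_pfac: "a2_op (pfac m) X = bridge_op X - bridge_eigval m \<bullet> X"
  unfolding pfac_def a2_op.add a2_op.diff a2_op_scale a2_op_one a2_op_bridge a2_op_arch
    bridge_eigval_def mf.scale_left_diff_distrib
  by simp

lemma wf_a2_add: "wf_a2 I \<Longrightarrow> wf_a2 J \<Longrightarrow> wf_a2 (I + J)"
  unfolding wf_a2_def using keys_add[of I J] by blast

lemma wf_a2_diff: "wf_a2 I \<Longrightarrow> wf_a2 J \<Longrightarrow> wf_a2 (I - J)"
  unfolding wf_a2_def using keys_diff[of I J] by blast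

lemma wf_a2_sum: "(\<And>i. i \<in> S \<Longrightarrow> wf_a2 (f i)) \<Longrightarrow> wf_a2 (\<Sum>i\<in>S. f i)"
  by (induction S rule: infinite_finite_induct) (simp_all add: wf_a2_add, simp_all add: wf_a2_def)

lemma wf_a2_single: "wf_share s \<Longrightarrow> wf_a2 (Poly_Mapping.single s a)"
  by (simp add: wf_a2_def)

lemma wf_a2_scale: "wf_a2 I \<Longrightarrow> wf_a2 (a2_scale a I)"
  unfolding a2_scale_def by (intro wf_a2_sum wf_a2_single) (simp add: wf_a2_def)

lemma lab_neq: "lab1 k \<noteq> lab2 l"
  using inj_lab(3) by blast

lemma count_list_map_lab:
  "count_list (map lab1 w) (lab1 l) = count_list w l"
  "count_list (map lab2 w) (lab2 l) = count_list w l"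
  "count_list (map lab1 w) (lab2 l) = 0"
  "count_list (map lab2 w) (lab1 l) = 0"
  by (auto simp: count_list_map_conv inj_lab count_list_0_iff lab_neq lab_neq[symmetric])

lemma wf_cross_share: "wf_share s \<Longrightarrow> wf_share t \<Longrightarrow> wf_share (cross_share s t)"
  unfolding wf_share_def cross_share_def by (auto simp: count_list_map_lab)

lemma count_list_join_share:
  "wf_share s \<Longrightarrow> wf_share t \<Longrightarrow> l \<in> set (join_share s t) \<Longrightarrow> count_list (join_share s t) l = 2"
  unfolding wf_share_def join_share_def by (auto simp: count_list_map_lab)

lemma wf_a2_cross: "wf_a2 I \<Longrightarrow> wf_a2 H \<Longrightarrow> wf_a2 (a2_cross I H)"
  unfolding a2_cross_def by (intro wf_a2_sum wf_a2_single wf_cross_share) (simp_all add: wf_a2_def)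

lemma wf_a2_generators: "wf_a2 a2_one" "wf_a2 arch" "wf_a2 bridge"
  by (simp_all add: a2_one_def arch_def bridge_def wf_a2_single wf_share_def)

lemma wf_a2_cpoly: "wf_a2 (cpoly q)"
proof -
  have "wf_a2 (a2_pow arch i)" for i
    by (induction i) (simp_all add: a2_pow_def wf_a2_generators wf_a2_cross)
  then show ?thesis unfolding cpoly_def by (intro wf_a2_sum wf_a2_scale)
qed

lemma keys_share_op_equivariant: "wf_a2 I \<Longrightarrow> s \<in> keys I \<Longrightarrow> sl2_equivariant (share_op s)"
  by (simp add: wf_a2_def share_op_equivariant)

lemma a2_op_equivariant:
  assumes "wf_a2 I"
  shows "sl2_equivariant (a2_op I)"
proof -
  have "a2_op I (X + Z) = a2_op I X + a2_op I Z" "a2_op I (p \<bullet> X) = p \<bullet> a2_op I X" for X Z p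
    by (simp_all add: a2_op_def a2_eval_def share_eval_def distrib_left distrib_right sum.distrib
        mf.scale_right_distrib mf.scale_sum_right mult.commute)
  moreover have "a2_op I (ad (sl2_x a) X) = ad (sl2_x a) (a2_op I X)" for a X
    unfolding a2_op_def a2_eval_def ad.sum ad.scale
    by (intro sum.cong refl arg_cong[of _ _ "smul _"] sl2_equivariant.ad_x
        keys_share_op_equivariant[OF assms])
  ultimately show ?thesis by unfold_locales
qed

lemma a2_op_e_power:
  assumes "wf_a2 I"
  shows "\<exists>z. a2_op I (sl2_e ^ l) = z \<bullet> sl2_e ^ l"
proof -
  have "\<exists>z. share_op s (sl2_e ^ l) = z \<bullet> sl2_e ^ l" if "s \<in> keys I" for s
  proof -
    interpret sl2_equivariant "share_op s"
      using assms that by (rule keys_share_op_equivariant)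
    show ?thesis
      using share_op_e_power_in_span_harmonics[of l s] e_power_eigenvector by blast
  qed
  then obtain z where "\<And>s. s \<in> keys I \<Longrightarrow> share_op s (sl2_e ^ l) = z s \<bullet> sl2_e ^ l" by metis
  then have "a2_op I (sl2_e ^ l) = (\<Sum>s\<in>keys I. cst (lookup I s) * z s) \<bullet> sl2_e ^ l"
    by (simp add: a2_op_def a2_eval_def mf.scale_sum_left)
  then show ?thesis by blast
qed

section \<open>The operators of the polynomials p_n\<close>

abbreviation pfac_prod :: "nat list \<Rightarrow> a2" where
  "pfac_prod ms \<equiv> foldr (\<lambda>m. a2_cross (pfac m)) ms a2_one"

lemma wf_a2_pp: "wf_a2 (pp n)"
proof -
  have "wf_a2 (pfac m)" for m
    unfolding pfac_def by (intro wf_a2_add wf_a2_diff wf_a2_scale wf_a2_generators)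
  then have "wf_a2 (pfac_prod ms)" for ms
    by (induction ms) (simp_all add: wf_a2_generators wf_a2_cross)
  then show ?thesis by (simp add: pp_def)
qed

primrec pp_op :: "nat \<Rightarrow> mfam \<Rightarrow> mfam" where
  "pp_op 0 X = X"
| "pp_op (Suc n) X = pp_op n (bridge_op X - bridge_eigval n \<bullet> X)"

lemma a2_op_pp: "a2_op (pp n) = pp_op n"
proof
  fix X
  have "a2_op (foldr (\<lambda>m. a2_cross (pfac m)) [0..<n] A) X = pp_op n (a2_op A X)" for A
    by (induction n arbitrary: A) (simp_all add: a2_op_cross a2_op_pfac)
  then show "a2_op (pp n) X = pp_op n X" by (simp add: pp_def a2_op_one)
qed

interpretation pp_op: sl2_equivariant "pp_op n" for n
  using a2_op_equivariant[OF wf_a2_pp[of n]] by (simp add: a2_op_pp)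

definition pp_eigval :: "nat \<Rightarrow> nat \<Rightarrow> complex" where
  "pp_eigval n l = (\<Prod>m<n. (of_nat (m * (m + 1)) - of_nat (l * (l + 1))) / 2)"

lemma pp_op_bridge_eigenvector:
  assumes "bridge_op X = bridge_eigval l \<bullet> X"
  shows "pp_op n X = cst (pp_eigval n l) \<bullet> X"
proof (induction n)
  case (Suc n)
  have "bridge_eigval l - bridge_eigval n = cst ((of_nat (n * (n + 1)) - of_nat (l * (l + 1))) / 2)"
    by (simp add: bridge_eigval_def field_simps)
  then have "bridge_op X - bridge_eigval n \<bullet> X =
      cst ((of_nat (n * (n + 1)) - of_nat (l * (l + 1))) / 2) \<bullet> X"
    by (simp add: assms flip: mf.scale_left_diff_distrib)
  then show ?case by (simp add: pp_op.scale Suc pp_eigval_def mult.commute)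
qed (simp add: pp_eigval_def)

lemmas pp_op_e_power = pp_op_bridge_eigenvector[OF bridge_op_e_power]

lemma pp_eigval_eq_0_iff: "pp_eigval n l = 0 \<longleftrightarrow> l < n"
  unfolding pp_eigval_def using pronic_eq_iff
  by (auto simp del: of_nat_mult of_nat_add)

lemma pp_op_xprod_eq_0:
  assumes "length w < n"
  shows "pp_op n (xprod w) = 0"
proof (rule sl2_equivariant_eq_on_span_harmonics[OF _ _ _ xprod_in_span_harmonics])
  show "sl2_equivariant (pp_op n)" by (rule pp_op.sl2_equivariant_axioms)
  show "sl2_equivariant (\<lambda>X. 0)" by unfold_locales simp_all
  show "pp_op n (sl2_e ^ l) = 0" if "l \<le> length w" for l
    using pp_eigval_eq_0_iff[of n l] assms that by (simp add: pp_op_e_power)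
qed

lemma a2_eval_pfac_prod_Cons:
  "a2_eval F (pfac_prod (m # ms)) =
    (\<Sum>a\<in>colours. a2_eval (\<lambda>u v. F (sl2_x a * u) (v * sl2_x a)) (pfac_prod ms))
    - (\<Sum>a\<in>colours. a2_eval (\<lambda>u v. F (sl2_x a * sl2_x a * u) v) (pfac_prod ms))
    + cst (of_nat (m * (m + 1)) / 2) \<bullet> a2_eval F (pfac_prod ms)"
  unfolding foldr.simps o_apply a2_eval_cross
  unfolding pfac_def a2_eval.add a2_eval.diff a2_eval_scale a2_eval_one a2_eval_bridge a2_eval_arch
  by (simp only: mult_1_left mult_1_right)

lemma a2_eval_pfac_prod_cong:
  assumes "\<And>u w. length w \<le> length ms \<Longrightarrow> F u (xprod w) = G u (xprod w)"
  shows "a2_eval F (pfac_prod ms) = a2_eval G (pfac_prod ms)"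
  using assms
proof (induction ms arbitrary: F G)
  case Nil
  show ?case using Nil[of "[]" 1] by (simp add: a2_eval_one)
next
  case (Cons m ms)
  have "a2_eval (\<lambda>u v. F (sl2_x a * u) (v * sl2_x a)) (pfac_prod ms) =
      a2_eval (\<lambda>u v. G (sl2_x a * u) (v * sl2_x a)) (pfac_prod ms)" for a
  proof (rule Cons.IH)
    show "F (sl2_x a * u) (xprod w * sl2_x a) = G (sl2_x a * u) (xprod w * sl2_x a)"
      if "length w \<le> length ms" for u w
      using Cons.prems[of "w @ [a]" "sl2_x a * u"] that by simp
  qed
  moreover have "a2_eval (\<lambda>u v. F (sl2_x a * sl2_x a * u) v) (pfac_prod ms) =
      a2_eval (\<lambda>u v. G (sl2_x a * sl2_x a * u) v) (pfac_prod ms)" for a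
    by (rule Cons.IH) (simp add: Cons.prems)
  moreover have "a2_eval F (pfac_prod ms) = a2_eval G (pfac_prod ms)"
    by (rule Cons.IH) (simp add: Cons.prems)
  ultimately show ?case by (simp only: a2_eval_pfac_prod_Cons)
qed

text \<open>Only the share of n bridges contributes: it is the one term of the product whose second
  strand has n letters.\<close>

lemma a2_eval_pfac_prod_top:
  assumes "\<And>u w. length w < length ms \<Longrightarrow> F u (xprod w) = 0"
  shows "a2_eval F (pfac_prod ms) = (\<Sum>w\<in>colour_words (length ms). F (xprod w) (xprod (rev w)))"
  using assms
proof (induction ms arbitrary: F)
  case Nil
  show ?case by (simp add: a2_eval_one)
next
  case (Cons m ms)
  have short: "a2_eval G (pfac_prod ms) = 0"
      if "\<And>u w. length w \<le> length ms \<Longrightarrow> G u (xprod w) = 0" for G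
  proof -
    have "a2_eval G (pfac_prod ms) = a2_eval (\<lambda>u v. 0) (pfac_prod ms)"
      by (rule a2_eval_pfac_prod_cong) (fact that)
    then show ?thesis by (simp only: a2_eval_zero_fun)
  qed
  have bridge: "a2_eval (\<lambda>u v. F (sl2_x a * u) (v * sl2_x a)) (pfac_prod ms) =
      (\<Sum>w\<in>colour_words (length ms). F (xprod (a # w)) (xprod (rev (a # w))))" for a
  proof (subst Cons.IH)
    show "F (sl2_x a * u) (xprod w * sl2_x a) = 0" if "length w < length ms" for u w
      using Cons.prems[of "w @ [a]" "sl2_x a * u"] that by simp
  qed simp
  have "a2_eval F (pfac_prod (m # ms)) =
      (\<Sum>a\<in>colours. a2_eval (\<lambda>u v. F (sl2_x a * u) (v * sl2_x a)) (pfac_prod ms))"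
    unfolding a2_eval_pfac_prod_Cons by (simp add: short Cons.prems del: sum.insert)
  then show ?case
    by (simp only: bridge sum_colour_words_Suc list.size(4) add_0_right add_Suc_right)
qed

section \<open>The bilinear form\<close>

definition tr :: "nat \<Rightarrow> mfam \<Rightarrow> complex" where
  "tr d X = (\<Sum>i<d. entry X d i i)"

lemma tr_simps [simp]:
  "tr d 0 = 0"
  "tr d 1 = of_nat d"
  "tr d (X + Z) = tr d X + tr d Z"
  "tr d (X - Z) = tr d X - tr d Z"
  "tr d (p \<bullet> X) = poly p (casimir_val d) * tr d X"
  by (simp_all add: tr_def entry_simps one_mfam.rep_eq mid_def sum.distrib sum_subtractf
      sum_distrib_left)

lemma tr_sum: "tr d (\<Sum>s\<in>S. f s) = (\<Sum>s\<in>S. tr d (f s))"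
  by (induction S rule: infinite_finite_induct) simp_all

lemma tr_mult_commute: "tr d (X * Z) = tr d (Z * X)"
  unfolding tr_def times_mfam.rep_eq mmul_def by (subst sum.swap) (simp add: mult.commute)

lemma tr_bridge_op: "tr d (bridge_op X * Z) = tr d (X * bridge_op Z)"
proof -
  have "tr d (sl2_x a * X * sl2_x a * Z) = tr d (X * (sl2_x a * Z * sl2_x a))" for a
    using tr_mult_commute[of d "sl2_x a" "X * sl2_x a * Z"] by (simp add: mult.assoc)
  then show ?thesis by (simp only: bridge_op_def sum_distrib_left sum_distrib_right tr_sum)
qed

lemma tr_pp_op: "tr d (pp_op n X * Z) = tr d (X * pp_op n Z)"
proof (induction n arbitrary: X)
  case (Suc n)
  have "tr d (pp_op (Suc n) X * Z) = tr d ((bridge_op X - bridge_eigval n \<bullet> X) * pp_op n Z)"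
    by (simp only: pp_op.simps Suc)
  also have "\<dots> = tr d (X * (bridge_op (pp_op n Z) - bridge_eigval n \<bullet> pp_op n Z))"
    by (simp add: left_diff_distrib right_diff_distrib tr_bridge_op)
  also have "\<dots> = tr d (X * pp_op (Suc n) Z)"
    by (simp add: pp_op.diff pp_op.scale pp_op.bridge_op_commute)
  finally show ?case .
qed simp

lemma tr_a2_eval_cong:
  assumes "\<And>u v. tr d (F u v) = tr d (G u v)"
  shows "tr d (a2_eval F I) = tr d (a2_eval G I)"
  by (simp add: a2_eval_def share_eval_def tr_sum assms)

lemma smul_one_eqI_tr:
  assumes "\<And>d. tr d (p \<bullet> 1) = tr d (q \<bullet> 1)"
  shows "p = q"
proof (rule poly_eqI_casimir)
  fix d :: nat assume "d > 0"
  then show "poly p (casimir_val d) = poly q (casimir_val d)" using assms[of d] by simp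
qed

lemma a2_form_smul_one_nested:
  assumes "wf_a2 I" "wf_a2 H"
  shows "a2_form I H \<bullet> 1 = a2_eval (\<lambda>u v. a2_eval (\<lambda>u' v'. u * u' * v * v') H) I"
proof -
  have "w_sl2 (join_share s t) \<bullet> 1 = word_sum (join_share s t)" if "s \<in> keys I" "t \<in> keys H" for s t
    using that assms
    by (intro word_sum_eq_w_sl2[symmetric] count_list_join_share) (auto simp: wf_a2_def)
  moreover have "smult (a * b) p \<bullet> 1 = cst a \<bullet> cst b \<bullet> p \<bullet> 1" for a b p
    by (simp add: mult.commute)
  ultimately have "a2_form I H \<bullet> 1 =
      (\<Sum>s\<in>keys I. \<Sum>t\<in>keys H. cst (lookup I s) \<bullet> cst (lookup H t) \<bullet> word_sum (join_share s t))"
    unfolding a2_form_def mf.scale_sum_left by (intro sum.cong refl) (simp only:)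
  also have "\<dots> = (\<Sum>s\<in>keys I. cst (lookup I s) \<bullet>
      share_eval (\<lambda>u v. a2_eval (\<lambda>u' v'. u * u' * v * v') H) s)"
    unfolding word_sum_join a2_eval_def share_eval_def[of _ "_ :: share"] mf.scale_sum_right
    by (intro sum.cong refl sum.swap)
  finally show ?thesis by (simp only: a2_eval_def[of _ I])
qed

lemma a2_form_smul_one:
  assumes "wf_a2 I" "wf_a2 H"
  shows "a2_form I H \<bullet> 1 = a2_eval (\<lambda>u v. a2_op I u * v) H"
proof -
  have "a2_eval (\<lambda>u v. u * u' * v * v') I = a2_op I u' * v'" for u' v'
    using a2_eval_mult[of 1 "\<lambda>u v. u * u' * v" I v'] by (simp add: a2_op_def)
  then show ?thesis
    unfolding a2_form_smul_one_nested[OF assms] by (subst a2_eval_swap) simp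
qed

lemma tr_a2_form:
  assumes "wf_a2 I" "wf_a2 H"
  shows "tr d (a2_form I H \<bullet> 1) = tr d (a2_eval (\<lambda>u v. a2_op H v * u) I)"
  unfolding a2_form_smul_one_nested[OF assms]
proof (rule tr_a2_eval_cong)
  fix u v
  have "tr d (a2_eval (\<lambda>u' v'. u * u' * v * v') H) = tr d (a2_eval (\<lambda>u' v'. u' * v * v' * u) H)"
    by (rule tr_a2_eval_cong) (simp add: tr_mult_commute[of d u] mult.assoc)
  also have "a2_eval (\<lambda>u' v'. u' * v * v' * u) H = a2_op H v * u"
    using a2_eval_mult[of 1 "\<lambda>u' v'. u' * v * v'" H u] by (simp add: a2_op_def)
  finally show "tr d (a2_eval (\<lambda>u' v'. u * u' * v * v') H) = tr d (a2_op H v * u)" .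
qed

lemma a2_form_eq_if_a2_sim:
  assumes "a2_sim I J" "wf_a2 H"
  shows "a2_form I H = a2_form J H"
proof -
  have expand: "a2_form K H =
      (\<Sum>t\<in>keys H. smult (lookup H t) (a2_form K (Poly_Mapping.single t 1)))" for K
    unfolding a2_form_def
    by (subst sum.swap) (rule poly_eqI, simp add: coeff_sum sum_distrib_left mult_ac)
  have "a2_form I (Poly_Mapping.single t 1) = a2_form J (Poly_Mapping.single t 1)"
      if "t \<in> keys H" for t
    using assms that unfolding a2_sim_def wf_a2_def by blast
  then show ?thesis
    unfolding expand[of I] expand[of J] by (simp cong: sum.cong)
qed

lemma a2_sim_if_a2_op_eq:
  assumes "wf_a2 I" "wf_a2 J" "\<And>w. a2_op I (xprod w) = a2_op J (xprod w)"
  shows "a2_sim I J"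
  unfolding a2_sim_def
proof (intro allI impI)
  fix H assume "wf_share H"
  then have wf: "wf_a2 (Poly_Mapping.single H 1)" by (rule wf_a2_single)
  have "a2_eval (\<lambda>u v. a2_op I u * v) (Poly_Mapping.single H 1) =
      a2_eval (\<lambda>u v. a2_op J u * v) (Poly_Mapping.single H 1)"
    by (rule a2_eval_cong) (simp only: assms(3))
  then show "a2_form I (Poly_Mapping.single H 1) = a2_form J (Poly_Mapping.single H 1)"
    by (simp only: a2_form_smul_one assms(1,2) wf flip: smul_one_eq_iff)
qed

lemma a2_form_pp_commute:
  assumes "wf_a2 I"
  shows "a2_form (pp n) I = a2_form I (pp n)"
proof (rule smul_one_eqI_tr)
  fix d
  have "tr d (a2_form (pp n) I \<bullet> 1) = tr d (a2_eval (\<lambda>u v. pp_op n u * v) I)"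
    by (simp only: a2_form_smul_one[OF wf_a2_pp assms] a2_op_pp)
  also have "\<dots> = tr d (a2_eval (\<lambda>u v. pp_op n v * u) I)"
    by (rule tr_a2_eval_cong) (metis tr_pp_op tr_mult_commute)
  also have "\<dots> = tr d (a2_form I (pp n) \<bullet> 1)"
    by (simp only: tr_a2_form[OF assms wf_a2_pp] a2_op_pp)
  finally show "tr d (a2_form (pp n) I \<bullet> 1) = tr d (a2_form I (pp n) \<bullet> 1)" .
qed

lemma a2_form_pp_eq_0:
  assumes "wf_a2 I" "\<And>s. s \<in> keys I \<Longrightarrow> length (snd s) < n"
  shows "a2_form I (pp n) = 0"
proof (rule smul_one_eqI_tr)
  fix d
  have "a2_eval (\<lambda>u v. pp_op n v * u) I = a2_eval (\<lambda>u v. 0) I"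
    using assms(2) by (intro a2_eval_cong) (simp add: pp_op_xprod_eq_0)
  then show "tr d (a2_form I (pp n) \<bullet> 1) = tr d (0 \<bullet> 1)"
    by (simp only: tr_a2_form[OF assms(1) wf_a2_pp] a2_op_pp a2_eval_zero_fun mf.scale_zero_left)
qed

lemma a2_form_pp_cong:
  assumes "wf_a2 I" "wf_a2 J" "\<And>w. length w \<le> n \<Longrightarrow> a2_op I (xprod w) = a2_op J (xprod w)"
  shows "a2_form (pp n) I = a2_form (pp n) J"
proof (rule smul_one_eqI_tr)
  fix d
  have "a2_eval (\<lambda>u v. a2_op I v * u) (pp n) = a2_eval (\<lambda>u v. a2_op J v * u) (pp n)"
    unfolding pp_def by (rule a2_eval_pfac_prod_cong) (simp add: assms(3))
  then show "tr d (a2_form (pp n) I \<bullet> 1) = tr d (a2_form (pp n) J \<bullet> 1)"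
    by (simp only: tr_a2_form wf_a2_pp assms(1,2))
qed

lemma pp_orthogonal:
  assumes "n \<noteq> k"
  shows "a2_form (pp n) (pp k) = 0"
proof -
  have less: "a2_form (pp n) (pp k) = 0" if "n < k" for n k
  proof -
    have "a2_form (pp n) (pp k) = a2_form (pp n) 0"
      using that by (intro a2_form_pp_cong wf_a2_pp)
        (simp_all add: a2_op_pp pp_op_xprod_eq_0 a2_op.zero wf_a2_def)
    then show ?thesis by (simp add: a2_form_def)
  qed
  show ?thesis
  proof (cases "n < k")
    case True
    then show ?thesis by (rule less)
  next
    case False
    then have "a2_form (pp k) (pp n) = 0" using assms by (intro less) simp
    then show ?thesis using a2_form_pp_commute[OF wf_a2_pp, of n k] by simp
  qed
qed

section \<open>Nondegeneracy of the form\<close>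

lift_definition dagger :: "mfam \<Rightarrow> mfam" is "\<lambda>A d i k. cnj (A d k i)" by auto

interpretation dagger: additive dagger
  by (rule additive.intro) (transfer; simp)

lemma dagger_mult: "dagger (X * Z) = dagger Z * dagger X"
  by transfer (simp add: mmul_def fun_eq_iff mult.commute)

lemma dagger_one: "dagger 1 = 1"
  by transfer (auto simp: mid_def fun_eq_iff)

lemma dagger_sl2_x: "dagger (sl2_x a) = sl2_x a"
  by transfer (auto simp: fun_eq_iff xgen_def jplus_def jminus_def jz_def)

lemma dagger_xprod: "dagger (xprod w) = xprod (rev w)"
  by (induction w) (simp_all add: dagger_one dagger_mult dagger_sl2_x)

lemma dagger_bridge_op: "dagger (bridge_op X) = bridge_op (dagger X)"
  by (simp only: bridge_op_def dagger.sum dagger_mult dagger_sl2_x mult.assoc)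

lemma dagger_bridge_eigval: "dagger (bridge_eigval n \<bullet> X) = bridge_eigval n \<bullet> dagger X"
  by transfer (simp add: bridge_eigval_def casimir_val_def)

lemma dagger_pp_op: "dagger (pp_op n X) = pp_op n (dagger X)"
  by (induction n arbitrary: X) (simp_all add: dagger.diff dagger_bridge_op dagger_bridge_eigval)

definition sqnorm :: "nat \<Rightarrow> mfam \<Rightarrow> real" where
  "sqnorm d X = (\<Sum>i<d. \<Sum>k<d. (cmod (entry X d i k))\<^sup>2)"

lemma sqnorm_nonneg: "sqnorm d X \<ge> 0"
  by (simp add: sqnorm_def sum_nonneg)

lemma sqnorm_eq_0_iff: "sqnorm d X = 0 \<longleftrightarrow> (\<forall>i k. entry X d i k = 0)"
  unfolding sqnorm_def using entry_outside[of _ d _ X]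
  by (auto simp: sum_nonneg_eq_0_iff sum_nonneg)

lemma tr_mult_dagger: "tr d (X * dagger X) = of_real (sqnorm d X)"
  by (simp add: tr_def sqnorm_def times_mfam.rep_eq mmul_def dagger.rep_eq
      complex_norm_square[unfolded of_real_power])

lemma pp_op_pp_op_xprod:
  assumes "length w = n"
  shows "pp_op n (pp_op n (xprod w)) = cst (pp_eigval n n) \<bullet> pp_op n (xprod w)"
proof (rule pp_op_bridge_eigenvector)
  have "pp_op (Suc n) (xprod w) = 0" using assms by (simp only: pp_op_xprod_eq_0 lessI)
  then show "bridge_op (pp_op n (xprod w)) = bridge_eigval n \<bullet> pp_op n (xprod w)"
    by (simp add: pp_op.diff pp_op.scale pp_op.bridge_op_commute)
qed

lemma tr_pp_op_xprod:
  assumes "length w = n"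
  shows "pp_eigval n n * tr d (pp_op n (xprod w) * xprod (rev w)) =
      of_real (sqnorm d (pp_op n (xprod w)))"
proof -
  have "pp_eigval n n * tr d (pp_op n (xprod w) * xprod (rev w))
      = tr d (pp_op n (pp_op n (xprod w)) * xprod (rev w))"
    by (simp add: pp_op_pp_op_xprod[OF assms])
  also have "\<dots> = tr d (pp_op n (xprod w) * dagger (pp_op n (xprod w)))"
    by (simp only: tr_pp_op[of d n "pp_op n _"] dagger_pp_op dagger_xprod)
  finally show ?thesis by (simp only: tr_mult_dagger)
qed

lemma pp_op_xprod_nonzero:
  assumes "n < d"
  shows "\<exists>w\<in>colour_words n. sqnorm d (pp_op n (xprod w)) \<noteq> 0"
proof (rule ccontr)
  let ?K = "{X. \<forall>i k. entry (pp_op n X) d i k = 0}"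
  assume "\<not> ?thesis"
  then have "xprod ` colour_words n \<subseteq> ?K" by (auto simp: sqnorm_eq_0_iff)
  moreover have "mf.subspace ?K"
    by (rule mf.subspaceI) (simp_all add: pp_op.add pp_op.scale entry_simps)
  ultimately have "sl2_e ^ n \<in> ?K"
    using e_power_in_span_xprod[of n] mf.span_minimal by blast
  then have "pp_eigval n n * entry (sl2_e ^ n) d 0 n = 0"
    by (auto simp: pp_op_e_power entry_simps)
  then show False
    using entry_e_power_nonzero[of 0 n d] assms by (simp add: pp_eigval_eq_0_iff)
qed

lemma a2_form_pp_self_nonzero: "a2_form (pp n) (pp n) \<noteq> 0"
proof
  define d where "d = Suc n"
  let ?W = "colour_words n"
  let ?t = "\<lambda>w. tr d (pp_op n (xprod (rev w)) * xprod (rev (rev w)))"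
  have fin: "finite ?W" unfolding colour_words_def by (rule finite_lists_length_eq) simp
  assume "a2_form (pp n) (pp n) = 0"
  then have "0 = tr d (a2_form (pp n) (pp n) \<bullet> 1)" by simp
  also have "\<dots> = tr d (a2_eval (\<lambda>u v. pp_op n v * u) (pp n))"
    by (simp only: tr_a2_form[OF wf_a2_pp wf_a2_pp] a2_op_pp)
  also have "a2_eval (\<lambda>u v. pp_op n v * u) (pp n) = (\<Sum>w\<in>?W. pp_op n (xprod (rev w)) * xprod w)"
    unfolding pp_def by (subst a2_eval_pfac_prod_top) (simp_all add: pp_op_xprod_eq_0)
  finally have "(\<Sum>w\<in>?W. ?t w) = 0" by (simp add: tr_sum)
  moreover have "pp_eigval n n * ?t w = of_real (sqnorm d (pp_op n (xprod (rev w))))"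
      if "w \<in> ?W" for w
    using that by (intro tr_pp_op_xprod) (simp add: length_colour_words)
  then have "complex_of_real (\<Sum>w\<in>?W. sqnorm d (pp_op n (xprod (rev w)))) =
      pp_eigval n n * (\<Sum>w\<in>?W. ?t w)"
    unfolding of_real_sum sum_distrib_left by (intro sum.cong refl) (simp only:)
  ultimately have "complex_of_real (\<Sum>w\<in>?W. sqnorm d (pp_op n (xprod (rev w)))) = 0"
    by simp
  then have "(\<Sum>w\<in>?W. sqnorm d (pp_op n (xprod (rev w)))) = 0" by (simp only: of_real_eq_0_iff)
  then have zero: "sqnorm d (pp_op n (xprod (rev w))) = 0" if "w \<in> ?W" for w
    using that fin by (simp add: sum_nonneg_eq_0_iff sqnorm_nonneg)
  obtain w where "w \<in> ?W" "sqnorm d (pp_op n (xprod w)) \<noteq> 0"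
    using pp_op_xprod_nonzero[of n d] by (auto simp: d_def)
  then show False using zero[of "rev w"] by (simp add: colour_words_def)
qed

section \<open>The basis\<close>

definition pp_comb :: "(nat \<Rightarrow> complex poly) \<Rightarrow> nat \<Rightarrow> a2" where
  "pp_comb q N = (\<Sum>n<N. a2_cross (cpoly (q n)) (pp n))"

lemma wf_a2_pp_comb: "wf_a2 (pp_comb q N)"
  unfolding pp_comb_def by (intro wf_a2_sum wf_a2_cross wf_a2_cpoly wf_a2_pp)

lemma a2_op_pp_comb: "a2_op (pp_comb q N) X = (\<Sum>n<N. q n \<bullet> pp_op n X)"
  by (simp add: pp_comb_def a2_op.sum a2_op_cross a2_op_cpoly a2_op_pp)

lemma a2_form_pp_comb:
  assumes "wf_a2 H"
  shows "a2_form (pp_comb q N) H = (\<Sum>n<N. q n * a2_form (pp n) H)"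
proof -
  have "a2_form (pp_comb q N) H \<bullet> 1 = (\<Sum>n<N. q n \<bullet> a2_eval (\<lambda>u v. pp_op n u * v) H)"
    by (simp add: a2_form_smul_one[OF wf_a2_pp_comb assms] a2_op_pp_comb sum_distrib_right
        a2_eval_sum_fun a2_eval_smul)
  also have "\<dots> = (\<Sum>n<N. q n * a2_form (pp n) H) \<bullet> 1"
    by (simp add: mf.scale_sum_left a2_form_smul_one[OF wf_a2_pp assms] a2_op_pp
        flip: mf.scale_scale)
  finally show ?thesis by (simp only: smul_one_eq_iff)
qed

lemma a2_form_pp_comb_pp:
  assumes "n < N"
  shows "a2_form (pp_comb q N) (pp n) = q n * a2_form (pp n) (pp n)"
proof -
  have "a2_form (pp_comb q N) (pp n) = (\<Sum>m<N. if m = n then q n * a2_form (pp n) (pp n) else 0)"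
    unfolding a2_form_pp_comb[OF wf_a2_pp] by (rule sum.cong) (auto simp: pp_orthogonal)
  then show ?thesis using assms by simp
qed

lemma a2_op_xprod_eq_pp_comb:
  assumes "wf_a2 I" "\<And>l. a2_op I (sl2_e ^ l) = z l \<bullet> sl2_e ^ l" "length w < N"
  shows "a2_op I (xprod w) = a2_op (pp_comb (newton_coeff pp_eigval z) N) (xprod w)"
proof (rule sl2_equivariant_eq_on_span_harmonics[OF _ _ _ xprod_in_span_harmonics])
  let ?q = "newton_coeff pp_eigval z"
  fix l assume "l \<le> length w"
  then have "(\<Sum>n<N. smult (pp_eigval n l) (?q n)) = (\<Sum>n\<le>l. smult (pp_eigval n l) (?q n))"
    using assms(3) by (intro sum.mono_neutral_right) (auto simp: pp_eigval_eq_0_iff)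
  also have "\<dots> = z l"
    by (rule sum_newton_coeff) (simp add: pp_eigval_eq_0_iff)
  finally have "z l = (\<Sum>n<N. ?q n * cst (pp_eigval n l))" by simp
  then show "a2_op I (sl2_e ^ l) = a2_op (pp_comb ?q N) (sl2_e ^ l)"
    by (simp only: a2_op_pp_comb pp_op_e_power assms(2) mf.scale_sum_left mf.scale_scale)
qed (simp_all add: a2_op_equivariant assms(1) wf_a2_pp_comb)

lemma a2_form_pp_eq_newton_coeff:
  assumes "wf_a2 I" "\<And>l. a2_op I (sl2_e ^ l) = z l \<bullet> sl2_e ^ l"
  shows "a2_form I (pp n) = newton_coeff pp_eigval z n * a2_form (pp n) (pp n)"
proof -
  let ?J = "pp_comb (newton_coeff pp_eigval z) (Suc n)"
  have "a2_form (pp n) I = a2_form (pp n) ?J"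
    using assms by (intro a2_form_pp_cong wf_a2_pp_comb a2_op_xprod_eq_pp_comb) auto
  then show ?thesis
    using a2_form_pp_commute[OF assms(1)] a2_form_pp_commute[OF wf_a2_pp_comb]
      a2_form_pp_comb_pp[of n "Suc n"] by simp
qed

lemma pp_spanning:
  assumes "wf_a2 I"
  shows "\<exists>N q. a2_sim I (pp_comb q N)"
proof -
  obtain z where eigval: "\<And>l. a2_op I (sl2_e ^ l) = z l \<bullet> sl2_e ^ l"
    using a2_op_e_power[OF assms] by metis
  let ?q = "newton_coeff pp_eigval z"
  obtain N where short: "\<And>s. s \<in> keys I \<Longrightarrow> length (snd s) < N"
    using finite_nat_set_iff_bounded[of "(\<lambda>s. length (snd s)) ` keys I"] by auto
  have coeff_eq_0: "?q n = 0" if "N \<le> n" for n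
  proof -
    have "a2_form I (pp n) = 0"
      using short that by (intro a2_form_pp_eq_0 assms) (meson less_le_trans)
    then show ?thesis
      by (simp add: a2_form_pp_eq_newton_coeff[OF assms eigval] a2_form_pp_self_nonzero)
  qed
  have "a2_op I (xprod w) = a2_op (pp_comb ?q N) (xprod w)" for w
  proof -
    have "a2_op I (xprod w) = (\<Sum>n<max N (Suc (length w)). ?q n \<bullet> pp_op n (xprod w))"
      unfolding a2_op_pp_comb[symmetric] by (rule a2_op_xprod_eq_pp_comb[OF assms eigval]) simp
    also have "\<dots> = (\<Sum>n<N. ?q n \<bullet> pp_op n (xprod w))"
      by (rule sum.mono_neutral_right) (auto simp: coeff_eq_0)
    finally show ?thesis by (simp only: a2_op_pp_comb)
  qed
  then have "a2_sim I (pp_comb ?q N)"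
    by (intro a2_sim_if_a2_op_eq assms wf_a2_pp_comb)
  then show ?thesis by blast
qed

lemma pp_independent:
  assumes "a2_sim (pp_comb q N) 0" "n < N"
  shows "q n = 0"
proof -
  have "q n * a2_form (pp n) (pp n) = a2_form 0 (pp n)"
    using a2_form_eq_if_a2_sim[OF assms(1) wf_a2_pp] a2_form_pp_comb_pp[OF assms(2)] by metis
  also have "\<dots> = 0" by (simp add: a2_form_def)
  finally show ?thesis using a2_form_pp_self_nonzero by simp
qed

theorem theorem5:
  shows "(\<forall>I. wf_a2 I \<longrightarrow>
            (\<exists>N (q :: nat \<Rightarrow> complex poly). a2_sim I (\<Sum>n<N. a2_cross (cpoly (q n)) (pp n))))
       \<and> (\<forall>N (q :: nat \<Rightarrow> complex poly).
            a2_sim (\<Sum>n<N. a2_cross (cpoly (q n)) (pp n)) 0 \<longrightarrow> (\<forall>n<N. q n = 0))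
       \<and> (\<forall>n k. n \<noteq> k \<longrightarrow> a2_form (pp n) (pp k) = 0)"
  using pp_spanning pp_independent pp_orthogonal unfolding pp_comb_def by blast

end
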